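(* Let $A=(B,O,S)$ be an abduction instance, let $P_{bpt}(A)$ be the ASP program defined in the context, and let $P_{gp}$ consist of the rules $$true(P)\leftarrow goal(P).$$ $$1\le\{\,infer(P)\,;\,fai(P)\,\}\le1\leftarrow true(P).$$ $$1\le\{\,inferVia(R,P): mayInferVia(R,P,\_)\,\}\le1\leftarrow infer(P).$$ $$true(Q)\leftarrow inferVia(R,P),\ inferenceNeeds(P,R,Q).$$ Then the answer sets of $P_{bpt}(A)\cup P_{gp}$ correspond 1-1 with the proof graphs $G$ induced by hypotheses $H\in\hat{\mathcal H}(A)$ via back-chaining: edges $E(G)$ are represented as $inferVia(\cdot,\cdot)$, nodes $N(G)$ as $true(\cdot)$, back-chained atoms as $infer(\cdot)$, and all other atoms as $fai(\cdot)$.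
   Context: **Abduction instances.** An abduction instance is a tuple $A=(B,O,S)$. Here $O$ (observation, goal) is an existentially quantified conjunction of atoms $\exists V_1,\dots,V_k: o_1(V_1,\dots,V_k)\wedge\cdots\wedge o_m(V_1,\dots,V_k)$, also regarded as a set of atoms, in which each existential variable $V_i$ is represented by a constant $v_i\notin S$. $B$ is a finite set of axioms, each a single-head Horn clause $$q(Y_1,\dots,Y_m)\Leftarrow p_1(X^1_1,\dots,X^1_{k_1})\wedge\cdots\wedge p_r(X^r_1,\dots,X^r_{k_r}),$$ with body variables $\mathcal X$, head variables $\mathcal Y\subseteq\mathcal X$, universally quantified over $\mathcal X$ (constants may also occur as arguments; they are left unchanged by the rewriting, and only head variables are arguments of Skolem terms). $S$ is a set of constants of $B$ called sort names. $B$ is assumed acyclic: no circular inferences are possible over the axioms. **Hypotheses.** A hypothesis is a conjunction of atoms and equalities between terms. The set $\hat{\mathcal H}(A)$ of all hypotheses of $A$ is obtained from $\{O\}$ by closing under two operations. *Back-chaining*: given an atom $P$ in a hypothesis $H$ that unifies via $\theta$ with the head of an axiom, add the hypothesis $H\wedge P_1'\wedge\cdots\wedge P_r'$ with $P_i'=\theta(p_i(X^i_1,\dots,X^i_{k_i}))$, where body variables not in the head are existential and are replaced by Skolem terms (value invention). *Unification*: given distinct atoms $P,Q\in H$ unifying under $\theta$ such that all $X\mapsto Y\in\theta$ obey $X,Y\notin S$, add $H\wedge\bigwedge\{X=Y\mid X\mapsto Y\in\theta\}$. **Proof graphs.** A proof graph $G$ wrt. $H\in\hat{\mathcal H}(A)$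 is an acyclic directed graph with nodes $N(G)=\{P\in H\mid P\text{ is not an equality}\}$ and edges $E(G)$ defined by the inference operations used to generate the atoms of $H$: back-chaining of $P$ induces an edge from each body atom $P_i'$ to $P$; unification of $P$ with $Q$ induces either an edge from $P$ to $Q$ or an edge from $Q$ to $P$. Only hypotheses and proof graphs are considered where each atom is justified by a single inference, or by a single factoring (directed unification), or not at all. "Via back-chaining" means that only back-chaining operations are used. **ASP program $P_{bpt}(A)$.** An atom $p(a,b)$ (or of other arity) is represented by the term $c(p,a,b)$. $P_{bpt}(A)$ consists of: - the fact $goal(c(o_i,v_1,\dots,v_k))$ for each atom of $O$, and the fact $sortname(s)$ for each $s\in S$; - for each axiom with unique identifier $a$ and $\{Z_1,\dots,Z_v\}=\mathcal X\setminus\mathcal Y$, the rules $$mayInferVia(a,c(q,Y_1,\dots,Y_m),l(Z_1,\dots,Z_v))\leftarrow pot(c(q,Y_1,\dots,Y_m)),\ Z_1=s(a,1,Y_1,\dots,Y_m),\dots,Z_v=s(a,v,Y_1,\dots,Y_m).$$ $$inferenceNeeds(c(q,Y_1,\dots,Y_m),a,c(p_i,X^i_1,\dots,X^i_{k_i}))\leftarrow mayInferVia(a,c(q,Y_1,\dots,Y_m),l(Z_1,\dots,Z_v)).\quad (1\le i\le r)$$ - the rules $pot(X)\leftarrow goal(X).$ and $pot(P)\leftarrow inferenceNeeds(\_,\_,P).$ An edge $(Q,P)$ arising from back-chaining of $P$ over axiom $R$ is represented by $inferVia(R,P)$ together with $inferenceNeeds(P,R,Q)$. Answer sets are those of standard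 ASP-Core-2 semantics; $1\le\{\dots\}\le1$ in a rule head is a choice of exactly one of the listed atoms, and $\{p(X):q(X)\}$ lists all $p(X)$ for which $q(X)$ is true; $\_$ is an anonymous variable. *)

theory Defs
  imports Main
begin

section \<open>Abduction instances\<close>

datatype 't atom = Atom (pred: string) (args: "'t list")

text \<open>Arguments occurring in axioms and observations are variables or constants.\<close>

datatype arg = Var string | Const string

text \<open>
  Terms of hypotheses: the constants (including those that represent existential variables) and
  the Skolem terms.  \<open>Skolem a i ts\<close> is the value invented for the \<open>i\<close>-th existential body
  variable (counted from 1) of the axiom with identifier \<open>a\<close>.
\<close>

datatype trm = Cst string | Skolem string nat "trm list"

type_synonym fact = "trm atom"

fun arg_vars :: "arg \<Rightarrow> string list" where
  "arg_vars (Var x) = [x]"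
| "arg_vars (Const c) = []"

fun arg_consts :: "arg \<Rightarrow> string list" where
  "arg_consts (Var x) = []"
| "arg_consts (Const c) = [c]"

definition atom_vars :: "arg atom \<Rightarrow> string list" where
  "atom_vars p = concat (map arg_vars (args p))"

definition atom_consts :: "arg atom \<Rightarrow> string list" where
  "atom_consts p = concat (map arg_consts (args p))"

fun inst_arg :: "(string \<Rightarrow> trm) \<Rightarrow> arg \<Rightarrow> trm" where
  "inst_arg \<theta> (Var x) = \<theta> x"
| "inst_arg \<theta> (Const c) = Cst c"

definition inst :: "(string \<Rightarrow> trm) \<Rightarrow> arg atom \<Rightarrow> fact" where
  "inst \<theta> = map_atom (inst_arg \<theta>)"

record axiom =
  ident :: string
  head :: "arg atom"
  body :: "arg atom list"

text \<open>The list of occurrences of head variables, from left to right.\<close>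

definition head_vars :: "axiom \<Rightarrow> string list" where
  "head_vars R = atom_vars (head R)"

definition body_vars :: "axiom \<Rightarrow> string list" where
  "body_vars R = concat (map atom_vars (body R))"

definition ex_vars :: "axiom \<Rightarrow> string list" where
  "ex_vars R = remdups (filter (\<lambda>x. x \<notin> set (head_vars R)) (body_vars R))"

text \<open>The existential body variables \<open>Z\<^sub>1, \<dots>, Z\<^sub>v\<close>, paired with their indices.\<close>

definition numbered_ex_vars :: "axiom \<Rightarrow> (string \<times> nat) list" where
  "numbered_ex_vars R = zip (ex_vars R) [1..<Suc (length (ex_vars R))]"

definition axiom_consts :: "axiom \<Rightarrow> string set" where
  "axiom_consts R = (\<Union>p \<in> insert (head R) (set (body R)). set (atom_consts p))"

text \<open>
  An axiom \<open>R'\<close> can be used directly after \<open>R\<close> if some body atom of \<open>R\<close> unifies (with variables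
  renamed apart) with the head of \<open>R'\<close>, that is, if the two have a common instance.
\<close>

definition feeds :: "axiom set \<Rightarrow> (axiom \<times> axiom) set" where
  "feeds B = {(R, R'). R \<in> B \<and> R' \<in> B \<and>
     (\<exists>p \<in> set (body R). \<exists>\<sigma> \<tau>. inst \<sigma> p = inst \<tau> (head R'))}"

text \<open>
  \<open>ex_const A V\<close> is the constant that represents the existential variable \<open>V\<close> of the observation.
\<close>

record abduction =
  axioms :: "axiom set"
  observation :: "arg atom set"
  ex_const :: "string \<Rightarrow> string"
  sorts :: "string set"

definition abduction_instance :: "abduction \<Rightarrow> bool" where
  "abduction_instance A \<longleftrightarrow>
     finite (axioms A) \<and> inj_on ident (axioms A) \<and>
     (\<forall>R \<in> axioms A. set (head_vars R) \<subseteq> set (body_vars R)) \<and>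
     acyclic (feeds (axioms A)) \<and>
     finite (observation A) \<and>
     (\<forall>p \<in> observation A. \<forall>V \<in> set (atom_vars p). ex_const A V \<notin> sorts A) \<and>
     sorts A \<subseteq> (\<Union>R \<in> axioms A. axiom_consts R)"

definition goals :: "abduction \<Rightarrow> fact set" where
  "goals A = inst (\<lambda>V. Cst (ex_const A V)) ` observation A"


section \<open>Hypotheses\<close>

datatype conjunct = Holds fact | Equal trm trm

type_synonym hypothesis = "conjunct set"

definition skolemize :: "axiom \<Rightarrow> (string \<Rightarrow> trm) \<Rightarrow> string \<Rightarrow> trm" where
  "skolemize R \<theta> x =
     (case map_of (numbered_ex_vars R) x of
        Some i \<Rightarrow> Skolem (ident R) i (map \<theta> (head_vars R))
      | None \<Rightarrow> \<theta> x)"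

text \<open>
  Facts contain no variables, so a unifier of a fact \<open>P\<close> with the head of an axiom is a
  substitution \<open>\<theta>\<close> for the head variables that maps the head to \<open>P\<close>.
\<close>

definition needs :: "axiom \<Rightarrow> fact \<Rightarrow> fact set" where
  "needs R P = {inst (skolemize R \<theta>) p | \<theta> p. inst \<theta> (head R) = P \<and> p \<in> set (body R)}"

definition applicable :: "axiom \<Rightarrow> fact \<Rightarrow> bool" where
  "applicable R P \<longleftrightarrow> (\<exists>\<theta>. inst \<theta> (head R) = P)"

text \<open>
  When two facts of a hypothesis are unified, their arguments (constants and Skolem terms)
  themselves play the role of variables; sort names must not take part.  The second conjunct says
  that \<open>\<theta>\<close> is an idempotent most general unifier, so that no equalities unrelated to the two
  facts arise.
\<close>

definition fact_unifier :: "(trm \<Rightarrow> trm) \<Rightarrow> fact \<Rightarrow> fact \<Rightarrow> bool" where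
  "fact_unifier \<theta> P Q \<longleftrightarrow> map_atom \<theta> P = map_atom \<theta> Q"

definition fact_mgu :: "(trm \<Rightarrow> trm) \<Rightarrow> fact \<Rightarrow> fact \<Rightarrow> bool" where
  "fact_mgu \<theta> P Q \<longleftrightarrow>
     fact_unifier \<theta> P Q \<and> (\<forall>\<delta>. fact_unifier \<delta> P Q \<longrightarrow> \<delta> \<circ> \<theta> = \<delta>)"

definition bindings :: "(trm \<Rightarrow> trm) \<Rightarrow> (trm \<times> trm) set" where
  "bindings \<theta> = {(X, \<theta> X) | X. \<theta> X \<noteq> X}"

definition sort_free :: "abduction \<Rightarrow> (trm \<Rightarrow> trm) \<Rightarrow> bool" where
  "sort_free A \<theta> \<longleftrightarrow> (\<forall>(X, Y) \<in> bindings \<theta>. X \<notin> Cst ` sorts A \<and> Y \<notin> Cst ` sorts A)"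

text \<open>\<open>Factor P Q\<close> is a unification of \<open>P\<close> and \<open>Q\<close>, directed from \<open>P\<close> to \<open>Q\<close>.\<close>

datatype inference = Backchain axiom fact | Factor fact fact

inductive step :: "abduction \<Rightarrow> hypothesis \<Rightarrow> inference \<Rightarrow> hypothesis \<Rightarrow> bool"
  for A :: abduction where
  backchaining: "step A H (Backchain R P) (H \<union> Holds ` needs R P)"
    if "Holds P \<in> H" "R \<in> axioms A" "applicable R P"
| unification: "step A H (Factor P Q) (H \<union> {Equal X Y | X Y. (X, Y) \<in> bindings \<theta>})"
    if "Holds P \<in> H" "Holds Q \<in> H" "P \<noteq> Q" "fact_mgu \<theta> P Q" "sort_free A \<theta>"

inductive_set hypotheses :: "abduction \<Rightarrow> hypothesis set" for A :: abduction where
  observe: "Holds ` goals A \<in> hypotheses A"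
| close: "H \<in> hypotheses A \<Longrightarrow> step A H s H' \<Longrightarrow> H' \<in> hypotheses A"

text \<open>\<open>derivation A H J\<close>: \<open>H\<close> can be generated by using exactly the operations in \<open>J\<close>.\<close>

inductive derivation :: "abduction \<Rightarrow> hypothesis \<Rightarrow> inference set \<Rightarrow> bool"
  for A :: abduction where
  "derivation A (Holds ` goals A) {}"
| "derivation A H J \<Longrightarrow> step A H s H' \<Longrightarrow> derivation A H' (insert s J)"

lemma hypotheses_iff_derivation: "H \<in> hypotheses A \<longleftrightarrow> (\<exists>J. derivation A H J)"
proof
  assume "H \<in> hypotheses A"
  then show "\<exists>J. derivation A H J"
    by induction (blast intro: derivation.intros)+
next
  assume "\<exists>J. derivation A H J"
  then obtain J where "derivation A H J" ..
  then show "H \<in> hypotheses A"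
    by induction (blast intro: hypotheses.intros)+
qed


section \<open>Proof graphs\<close>

text \<open>
  A proof graph records, besides nodes and edges, which operations induce the edges: different
  axioms may yield the same edges, and an axiom with empty body yields none.
\<close>

record proof_graph =
  nodes :: "fact set"
  edges :: "(fact \<times> fact) set"
  inferences :: "inference set"

fun induced_edges :: "inference \<Rightarrow> (fact \<times> fact) set" where
  "induced_edges (Backchain R P) = needs R P \<times> {P}"
| "induced_edges (Factor P Q) = {(P, Q)}"

fun justified :: "inference \<Rightarrow> fact" where
  "justified (Backchain R P) = P"
| "justified (Factor P Q) = Q"

definition is_proof_graph :: "abduction \<Rightarrow> hypothesis \<Rightarrow> proof_graph \<Rightarrow> bool" where
  "is_proof_graph A H G \<longleftrightarrow>
     derivation A H (inferences G) \<and>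
     nodes G = {P. Holds P \<in> H} \<and>
     edges G = (\<Union>s \<in> inferences G. induced_edges s) \<and>
     acyclic (edges G) \<and>
     inj_on justified (inferences G)"

definition via_backchaining :: "proof_graph \<Rightarrow> bool" where
  "via_backchaining G \<longleftrightarrow> inferences G \<subseteq> {Backchain R P | R P. True}"

definition backchained :: "proof_graph \<Rightarrow> fact set" where
  "backchained G = {P. \<exists>R. Backchain R P \<in> inferences G}"


section \<open>Answer set programs (ASP-Core-2)\<close>

text \<open>Constants are function symbols of arity 0.\<close>

datatype aterm = AVar string | ANum int | AFun string "aterm list"

type_synonym aatom = "aterm atom"

datatype lit = Pos aatom | Neg aatom | Eq aterm aterm

text \<open>
  \<open>Disj [h\<^sub>1, \<dots>, h\<^sub>n] b\<close> is a rule with head \<open>h\<^sub>1 | \<dots> | h\<^sub>n\<close>.  \<open>Choice l es u b\<close> is the rule with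
  head \<open>l \<le> {a\<^sub>1 : ls\<^sub>1; \<dots>; a\<^sub>n : ls\<^sub>n} \<le> u\<close>, where \<open>es = [(a\<^sub>1, ls\<^sub>1), \<dots>, (a\<^sub>n, ls\<^sub>n)]\<close>.
\<close>

datatype rule =
    Disj "aatom list" "lit list"
  | Choice nat "(aatom \<times> lit list) list" nat "lit list"

type_synonym prog = "rule set"

fun subst :: "(string \<Rightarrow> aterm) \<Rightarrow> aterm \<Rightarrow> aterm" where
  "subst \<sigma> (AVar x) = \<sigma> x"
| "subst \<sigma> (ANum n) = ANum n"
| "subst \<sigma> (AFun f ts) = AFun f (map (subst \<sigma>) ts)"

abbreviation subst_atom :: "(string \<Rightarrow> aterm) \<Rightarrow> aatom \<Rightarrow> aatom" where
  "subst_atom \<sigma> \<equiv> map_atom (subst \<sigma>)"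

fun subst_lit :: "(string \<Rightarrow> aterm) \<Rightarrow> lit \<Rightarrow> lit" where
  "subst_lit \<sigma> (Pos a) = Pos (subst_atom \<sigma> a)"
| "subst_lit \<sigma> (Neg a) = Neg (subst_atom \<sigma> a)"
| "subst_lit \<sigma> (Eq s t) = Eq (subst \<sigma> s) (subst \<sigma> t)"

fun vars :: "aterm \<Rightarrow> string set" where
  "vars (AVar x) = {x}"
| "vars (ANum n) = {}"
| "vars (AFun f ts) = (\<Union>t \<in> set ts. vars t)"

fun symbols :: "aterm \<Rightarrow> (string \<times> nat) set" where
  "symbols (AVar x) = {}"
| "symbols (ANum n) = {}"
| "symbols (AFun f ts) = insert (f, length ts) (\<Union>t \<in> set ts. symbols t)"

fun lit_terms :: "lit \<Rightarrow> aterm set" where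
  "lit_terms (Pos a) = set (args a)"
| "lit_terms (Neg a) = set (args a)"
| "lit_terms (Eq s t) = {s, t}"

abbreviation lits_terms :: "lit list \<Rightarrow> aterm set" where
  "lits_terms ls \<equiv> (\<Union>l \<in> set ls. lit_terms l)"

fun rule_terms :: "rule \<Rightarrow> aterm set" where
  "rule_terms (Disj hs b) = (\<Union>h \<in> set hs. set (args h)) \<union> lits_terms b"
| "rule_terms (Choice l es u b) = (\<Union>(a, ls) \<in> set es. set (args a) \<union> lits_terms ls) \<union> lits_terms b"

text \<open>All integers belong to the Herbrand universe.\<close>

definition herbrand_universe :: "prog \<Rightarrow> aterm set" where
  "herbrand_universe P =
     {t. vars t = {} \<and> symbols t \<subseteq> (\<Union>r \<in> P. \<Union>u \<in> rule_terms r. symbols u)}"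

definition groundings :: "prog \<Rightarrow> (string \<Rightarrow> aterm) set" where
  "groundings P = {\<sigma>. range \<sigma> \<subseteq> herbrand_universe P}"

text \<open>
  ASP-Core-2 defines a choice rule \<open>l \<le> {a\<^sub>1 : ls\<^sub>1; \<dots>} \<le> u \<leftarrow> b\<close> as a shortcut for the disjunctive
  rules \<open>a\<^sub>i | Hat a\<^sub>i \<leftarrow> b, ls\<^sub>i\<close> and the constraint
  \<open>\<leftarrow> b, not l \<le> #count {Hat a\<^sub>i : a\<^sub>i, ls\<^sub>i; \<dots>} \<le> u\<close>, where \<open>Hat a\<close> is an auxiliary atom for \<open>a\<close>.
  Auxiliary atoms are not part of the answer sets reported below.
\<close>

datatype xatom = Plain aatom | Hat aatom

type_synonym interp = "xatom set"

fun sat :: "interp \<Rightarrow> lit \<Rightarrow> bool" where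
  "sat X (Pos a) \<longleftrightarrow> Plain a \<in> X"
| "sat X (Neg a) \<longleftrightarrow> Plain a \<notin> X"
| "sat X (Eq s t) \<longleftrightarrow> s = t"

definition sats :: "interp \<Rightarrow> (string \<Rightarrow> aterm) \<Rightarrow> lit list \<Rightarrow> bool" where
  "sats X \<sigma> ls \<longleftrightarrow> (\<forall>l \<in> set ls. sat X (subst_lit \<sigma> l))"

text \<open>
  The tuples counted for the instance of a choice rule given by \<open>\<sigma>\<close>: only the variables of the
  body are global, all others are local to the choice elements.
\<close>

definition chosen ::
  "prog \<Rightarrow> interp \<Rightarrow> (string \<Rightarrow> aterm) \<Rightarrow> (aatom \<times> lit list) list \<Rightarrow> lit list \<Rightarrow> xatom set" where
  "chosen P X \<sigma> es b =
     {Hat (subst_atom \<tau> a) | \<tau> a ls. (a, ls) \<in> set es \<and> \<tau> \<in> groundings P \<and>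
        (\<forall>x \<in> (\<Union>t \<in> lits_terms b. vars t). \<tau> x = \<sigma> x) \<and>
        Plain (subst_atom \<tau> a) \<in> X \<and> sats X \<tau> ls}"

text \<open>
  A ground rule is given by its set of head atoms and the condition under which an interpretation
  satisfies its body.
\<close>

type_synonym ground_rule = "xatom set \<times> (interp \<Rightarrow> bool)"

fun ground_rules :: "prog \<Rightarrow> rule \<Rightarrow> ground_rule set" where
  "ground_rules P (Disj hs b) =
     {(Plain ` subst_atom \<sigma> ` set hs, \<lambda>X. sats X \<sigma> b) | \<sigma>. \<sigma> \<in> groundings P}"
| "ground_rules P (Choice l es u b) =
     {({Plain (subst_atom \<sigma> a), Hat (subst_atom \<sigma> a)}, \<lambda>X. sats X \<sigma> b \<and> sats X \<sigma> ls)
        | \<sigma> a ls. \<sigma> \<in> groundings P \<and> (a, ls) \<in> set es} \<union>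
     {({}, \<lambda>X. sats X \<sigma> b \<and>
             \<not> (finite (chosen P X \<sigma> es b) \<and>
                l \<le> card (chosen P X \<sigma> es b) \<and> card (chosen P X \<sigma> es b) \<le> u))
        | \<sigma>. \<sigma> \<in> groundings P}"

definition ground :: "prog \<Rightarrow> ground_rule set" where
  "ground P = (\<Union>r \<in> P. ground_rules P r)"

definition model :: "ground_rule set \<Rightarrow> interp \<Rightarrow> bool" where
  "model Gr X \<longleftrightarrow> (\<forall>(h, b) \<in> Gr. b X \<longrightarrow> h \<inter> X \<noteq> {})"

text \<open>The Faber-Leone-Pfeifer reduct.\<close>

definition reduct :: "ground_rule set \<Rightarrow> interp \<Rightarrow> ground_rule set" where
  "reduct Gr X = {(h, b) \<in> Gr. b X}"

definition answer_set :: "prog \<Rightarrow> aatom set \<Rightarrow> bool" where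
  "answer_set P I \<longleftrightarrow>
     (\<exists>X. model (ground P) X \<and> (\<forall>Y. Y \<subset> X \<longrightarrow> \<not> model (reduct (ground P) X) Y) \<and>
          I = {a. Plain a \<in> X})"


section \<open>The encoding\<close>

fun enc_arg :: "arg \<Rightarrow> aterm" where
  "enc_arg (Var x) = AVar x"
| "enc_arg (Const c) = AFun c []"

fun enc_trm :: "trm \<Rightarrow> aterm" where
  "enc_trm (Cst c) = AFun c []"
| "enc_trm (Skolem a i ts) = AFun ''s'' (AFun a [] # ANum (int i) # map enc_trm ts)"

definition enc_pattern :: "arg atom \<Rightarrow> aterm" where
  "enc_pattern p = AFun ''c'' (AFun (pred p) [] # map enc_arg (args p))"

definition enc_fact :: "fact \<Rightarrow> aterm" where
  "enc_fact P = AFun ''c'' (AFun (pred P) [] # map enc_trm (args P))"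

definition may_infer_via_atom :: "axiom \<Rightarrow> aatom" where
  "may_infer_via_atom R =
     Atom ''mayInferVia''
       [AFun (ident R) [], enc_pattern (head R), AFun ''l'' (map AVar (ex_vars R))]"

definition may_infer_via_rule :: "axiom \<Rightarrow> rule" where
  "may_infer_via_rule R =
     Disj [may_infer_via_atom R]
       (Pos (Atom ''pot'' [enc_pattern (head R)]) #
        map (\<lambda>(z, i). Eq (AVar z)
               (AFun ''s'' (AFun (ident R) [] # ANum (int i) # map AVar (head_vars R))))
          (numbered_ex_vars R))"

definition inference_needs_rule :: "axiom \<Rightarrow> arg atom \<Rightarrow> rule" where
  "inference_needs_rule R p =
     Disj [Atom ''inferenceNeeds'' [enc_pattern (head R), AFun (ident R) [], enc_pattern p]]
       [Pos (may_infer_via_atom R)]"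

text \<open>Each anonymous variable is written as a variable that occurs nowhere else in its rule.\<close>

definition P_bpt :: "abduction \<Rightarrow> prog" where
  "P_bpt A =
     {Disj [Atom ''goal'' [enc_fact P]] [] | P. P \<in> goals A} \<union>
     {Disj [Atom ''sortname'' [AFun s []]] [] | s. s \<in> sorts A} \<union>
     {may_infer_via_rule R | R. R \<in> axioms A} \<union>
     {inference_needs_rule R p | R p. R \<in> axioms A \<and> p \<in> set (body R)} \<union>
     {Disj [Atom ''pot'' [AVar ''X'']] [Pos (Atom ''goal'' [AVar ''X''])],
      Disj [Atom ''pot'' [AVar ''P'']]
        [Pos (Atom ''inferenceNeeds'' [AVar ''_1'', AVar ''_2'', AVar ''P''])]}"

definition P_gp :: prog where
  "P_gp =
     {Disj [Atom ''true'' [AVar ''P'']] [Pos (Atom ''goal'' [AVar ''P''])],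
      Choice 1 [(Atom ''infer'' [AVar ''P''], []), (Atom ''fai'' [AVar ''P''], [])] 1
        [Pos (Atom ''true'' [AVar ''P''])],
      Choice 1
        [(Atom ''inferVia'' [AVar ''R'', AVar ''P''],
          [Pos (Atom ''mayInferVia'' [AVar ''R'', AVar ''P'', AVar ''_1''])])] 1
        [Pos (Atom ''infer'' [AVar ''P''])],
      Disj [Atom ''true'' [AVar ''Q'']]
        [Pos (Atom ''inferVia'' [AVar ''R'', AVar ''P'']),
         Pos (Atom ''inferenceNeeds'' [AVar ''P'', AVar ''R'', AVar ''Q''])]}"

definition represents :: "aatom set \<Rightarrow> proof_graph \<Rightarrow> bool" where
  "represents I G \<longleftrightarrow>
     {t. Atom ''true'' [t] \<in> I} = enc_fact ` nodes G \<and>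
     {t. Atom ''infer'' [t] \<in> I} = enc_fact ` backchained G \<and>
     {t. Atom ''fai'' [t] \<in> I} = enc_fact ` (nodes G - backchained G) \<and>
     {(r, t). Atom ''inferVia'' [r, t] \<in> I} =
       {(AFun (ident R) [], enc_fact P) | R P. Backchain R P \<in> inferences G} \<and>
     {(u, t). \<exists>r. Atom ''inferVia'' [r, t] \<in> I \<and> Atom ''inferenceNeeds'' [t, r, u] \<in> I} =
       {(enc_fact Q, enc_fact P) | Q P. (Q, P) \<in> edges G}"

end

theory Submission
  imports Defs
begin

text \<open>
  Both sides of the correspondence are parametrized by the admissible sets \<open>J\<close> of back-chaining
  operations: those in which every operation applies to a fact that is reachable from the goals
  by operations in \<open>J\<close>, and no fact is back-chained twice.  Acyclicity of the axioms makes the set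
  of all potential facts finite and the induced edges acyclic, so an admissible \<open>J\<close> is finite
  and can be carried out in some order; this yields the proof graphs.  On the other side, the rules
  of \<open>P_bpt\<close> are satisfied by their least model, and cutting an answer set down to the atoms
  that are founded in the operations chosen by \<open>inferVia\<close> leaves a model of the reduct, so
  by minimality the answer set is determined by these operations.
\<close>

section \<open>Instances and needed facts\<close>

text \<open>A choice rule stands for disjunctions \<open>a | Hat a\<close> and a counting
  constraint, and the \<open>Hat\<close> atoms are invisible in the reported answer set. Minimality
  concerns the full interpretation, so to exhibit an answer set for \<open>J\<close> its
  \<open>Hat\<close> atoms are fixed too: they mark the alternatives not taken. In the reduct by a
  model the constraints vanish, since their bodies are false in that model. Minimality thus rests on
  the other rules, while the constraints are read in the model itself, to get exactly one
  alternative. A second obstacle is one of order. A priori an answer set may contain atoms whose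
  arguments encode no fact, and the constraint on \<open>inferVia\<close> can be evaluated only once
  the \<open>mayInferVia\<close> atoms are known. Hence the upper bound on the atoms precedes all
  counting. Finally, groundings are total assignments into the Herbrand universe, so every fact,
  identifier and Skolem list passed to a rule has to be located there.\<close>

lemma inst_arg_eq_iff: "inst_arg \<theta> a = inst_arg \<theta>' a \<longleftrightarrow> (\<forall>x \<in> set (arg_vars a). \<theta> x = \<theta>' x)"
  by (cases a) auto

lemma inst_eq_iff: "inst \<theta> p = inst \<theta>' p \<longleftrightarrow> (\<forall>x \<in> set (atom_vars p). \<theta> x = \<theta>' x)"
  by (cases p) (auto simp: inst_def atom_vars_def inst_arg_eq_iff)

lemma set_ex_vars: "set (ex_vars R) = set (body_vars R) - set (head_vars R)"
  by (auto simp: ex_vars_def)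

lemma fst_numbered_ex_vars: "map fst (numbered_ex_vars R) = ex_vars R"
  by (simp add: numbered_ex_vars_def del: upt_Suc)

lemma ex_vars_numbered: "z \<in> set (ex_vars R) \<Longrightarrow> \<exists>i. (z, i) \<in> set (numbered_ex_vars R)"
  by (metis fst_numbered_ex_vars in_set_zipE list.set_map imageE prod.collapse)

lemma numbered_ex_varsD: "(z, i) \<in> set (numbered_ex_vars R) \<Longrightarrow> z \<in> set (ex_vars R)"
  by (metis fst_conv fst_numbered_ex_vars image_eqI list.set_map)

lemma skolemize_head: "x \<in> set (head_vars R) \<Longrightarrow> skolemize R \<theta> x = \<theta> x"
proof -
  assume "x \<in> set (head_vars R)"
  then have "x \<notin> fst ` set (numbered_ex_vars R)"
    by (metis DiffD2 fst_numbered_ex_vars list.set_map set_ex_vars)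
  then show ?thesis
    by (simp add: skolemize_def map_of_eq_None_iff[THEN iffD2])
qed

lemma skolemize_ex:
  assumes "(z, i) \<in> set (numbered_ex_vars R)"
  shows "skolemize R \<theta> z = Skolem (ident R) i (map \<theta> (head_vars R))"
proof -
  have "distinct (map fst (numbered_ex_vars R))"
    by (simp add: fst_numbered_ex_vars ex_vars_def)
  with assms have "map_of (numbered_ex_vars R) z = Some i"
    by simp
  then show ?thesis
    by (simp add: skolemize_def)
qed

lemma atom_vars_body: "p \<in> set (body R) \<Longrightarrow> set (atom_vars p) \<subseteq> set (body_vars R)"
  by (auto simp: body_vars_def)

text \<open>A Skolem term carries the values of the head variables as arguments, so agreement on
  those settles every variable of the axiom.\<close>

lemma skolemize_cong:
  assumes "\<forall>x \<in> set (head_vars R). \<theta> x = \<theta>' x" "x \<in> set (head_vars R) \<union> set (body_vars R)"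
  shows "skolemize R \<theta> x = skolemize R \<theta>' x"
proof (cases "x \<in> set (head_vars R)")
  case True
  then show ?thesis
    using assms by (simp add: skolemize_head)
next
  case False
  with assms have "x \<in> set (ex_vars R)"
    by (simp add: set_ex_vars)
  then obtain i where "(x, i) \<in> set (numbered_ex_vars R)"
    using ex_vars_numbered by blast
  then have "skolemize R \<sigma> x = Skolem (ident R) i (map \<sigma> (head_vars R))" for \<sigma>
    by (rule skolemize_ex)
  then show ?thesis
    using assms(1) by simp
qed

text \<open>Two matches of the head agree on its variables and, by \<open>skolemize_cong\<close>,
  Skolemize the body alike. The union over all matches is therefore the image under any one of them,
  which makes \<open>needs R P\<close> finite.\<close>

lemma needs_eq:
  assumes "inst \<theta> (head R) = P"
  shows "needs R P = inst (skolemize R \<theta>) ` set (body R)"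
proof -
  have "inst (skolemize R \<theta>') p = inst (skolemize R \<theta>) p"
    if "inst \<theta>' (head R) = P" "p \<in> set (body R)" for \<theta>' p
  proof -
    have "\<forall>x \<in> set (head_vars R). \<theta>' x = \<theta> x"
      using that(1) assms inst_eq_iff[of \<theta>' "head R" \<theta>] by (simp add: head_vars_def)
    then show ?thesis
      using that(2) atom_vars_body[of p R] skolemize_cong[of R \<theta>' \<theta>]
      by (auto simp: inst_eq_iff)
  qed
  then show ?thesis
    using assms unfolding needs_def by (intro equalityI subsetI) (blast | force)+
qed

lemma needs_applicable: "Q \<in> needs R P \<Longrightarrow> applicable R P"
  by (auto simp: needs_def applicable_def)

lemma finite_needs: "finite (needs R P)"
proof (cases "applicable R P")
  case True
  then show ?thesis
    by (auto simp: applicable_def needs_eq)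
next
  case False
  then have "needs R P = {}"
    using needs_applicable by blast
  then show ?thesis
    by simp
qed

text \<open>The fact \<open>Q\<close> itself is the common instance of a body atom of
  \<open>R\<close> and the head of \<open>R'\<close>. This carries acyclicity of the axioms over to
  facts.\<close>

lemma needs_feeds:
  assumes "Q \<in> needs R P" "applicable R' Q" "R \<in> B" "R' \<in> B"
  shows "(R, R') \<in> feeds B"
proof -
  obtain \<theta> p \<tau> where "p \<in> set (body R)" "inst (skolemize R \<theta>) p = Q" "inst \<tau> (head R') = Q"
    using assms(1,2) unfolding needs_def applicable_def by blast
  then have "\<exists>p \<in> set (body R). \<exists>\<sigma> \<tau>. inst \<sigma> p = inst \<tau> (head R')"
    by metis
  then show ?thesis
    using assms(3,4) by (simp add: feeds_def)
qed


section \<open>Facts reachable by back-chaining\<close>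

inductive_set reach :: "fact set \<Rightarrow> inference set \<Rightarrow> fact set"
  for S :: "fact set" and J :: "inference set" where
  start: "P \<in> S \<Longrightarrow> P \<in> reach S J"
| need: "P \<in> reach S J \<Longrightarrow> Backchain R P \<in> J \<Longrightarrow> Q \<in> needs R P \<Longrightarrow> Q \<in> reach S J"

lemma reach_least:
  assumes "S \<subseteq> N" "\<And>R P. Backchain R P \<in> J \<Longrightarrow> P \<in> N \<Longrightarrow> needs R P \<subseteq> N"
  shows "reach S J \<subseteq> N"
proof
  fix P assume "P \<in> reach S J"
  then show "P \<in> N"
    by induction (use assms in blast)+
qed

lemma reach_mono: "J \<subseteq> J' \<Longrightarrow> reach S J \<subseteq> reach S J'"
  by (rule reach_least) (auto intro: reach.intros)

definition all_backchains :: "abduction \<Rightarrow> inference set" where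
  "all_backchains A = {Backchain R P | R P. R \<in> axioms A}"

abbreviation potentials :: "abduction \<Rightarrow> fact set" where
  "potentials A \<equiv> reach (goals A) (all_backchains A)"

text \<open>\<open>reach\<close> grows at the last operation. The induction in
  \<open>finite_potentials\<close> needs the first one split off instead, so that the rest starts
  from \<open>needs R P\<close>.\<close>

lemma reach_all_backchains_unfold:
  "reach S (all_backchains A) \<subseteq>
     S \<union> (\<Union>P \<in> S. \<Union>R \<in> axioms A. reach (needs R P) (all_backchains A))"
  (is "_ \<subseteq> ?N")
proof (rule reach_least)
  fix R P assume *: "Backchain R P \<in> all_backchains A" "P \<in> ?N"
  then have R: "R \<in> axioms A"
    by (simp add: all_backchains_def)
  from *(2) show "needs R P \<subseteq> ?N"
  proof
    assume "P \<in> S"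
    then show ?thesis
      using R by (auto intro: reach.start)
  next
    assume "P \<in> (\<Union>P \<in> S. \<Union>R \<in> axioms A. reach (needs R P) (all_backchains A))"
    then show ?thesis
      using *(1) by (blast intro: reach.need)
  qed
qed simp

text \<open>Successive operations are linked by \<open>feeds\<close>, so well-founded induction on
  the axiom bounds the facts below a single operation. Branching is finite because
  \<open>needs R P\<close> and the set of axioms are.\<close>

lemma finite_potentials:
  assumes A: "abduction_instance A"
  shows "finite (potentials A)"
proof -
  let ?B = "axioms A"
  let ?J = "all_backchains A"
  have B: "finite ?B"
    using A by (simp add: abduction_instance_def)
  have "feeds ?B \<subseteq> ?B \<times> ?B"
    by (auto simp: feeds_def)
  then have "finite (feeds ?B)"
    using B finite_subset by blast
  moreover have "acyclic (feeds ?B)"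
    using A by (simp add: abduction_instance_def)
  ultimately have wf: "wf ((feeds ?B)\<inverse>)"
    by (rule finite_acyclic_wf_converse)
  have *: "\<forall>P. R \<in> ?B \<longrightarrow> finite (reach (needs R P) ?J)" for R
    using wf
  proof (induction R)
    case (less R)
    \<comment> \<open>Either \<open>R\<close> feeds \<open>R'\<close> and the induction hypothesis
      applies, or \<open>R'\<close> does not match \<open>Q\<close> and nothing is reached.\<close>
    have "finite (reach (needs R' Q) ?J)"
      if "R \<in> ?B" "Q \<in> needs R P" "R' \<in> ?B" for P Q R'
    proof (cases "applicable R' Q")
      case True
      then show ?thesis
        using that less needs_feeds by blast
    next
      case False
      then have "needs R' Q = {}"
        using needs_applicable by blast
      moreover have "reach {} ?J \<subseteq> {}"
        by (rule reach_least) auto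
      ultimately show ?thesis
        by simp
    qed
    then show ?case
      using B finite_needs
      by (blast intro: finite_subset[OF reach_all_backchains_unfold])
  qed
  have "finite (goals A)"
    using A by (simp add: abduction_instance_def goals_def)
  then show ?thesis
    using B * by (blast intro: finite_subset[OF reach_all_backchains_unfold])
qed


section \<open>Proof graphs by back-chaining are determined by their inferences\<close>

text \<open>\<open>reach\<close> is a least fixed point, so the occurrence of \<open>J\<close> on
  both sides does not let operations support each other in a circle. Applicability is listed
  separately because an axiom with empty body needs nothing whether it matches or not.\<close>

definition admissible :: "abduction \<Rightarrow> inference set \<Rightarrow> bool" where
  "admissible A J \<longleftrightarrow>
     J \<subseteq> {Backchain R P | R P. R \<in> axioms A \<and> applicable R P \<and> P \<in> reach (goals A) J} \<and>
     inj_on justified J"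

lemma admissibleD:
  assumes "admissible A J" "Backchain R P \<in> J"
  shows "R \<in> axioms A" "applicable R P" "P \<in> reach (goals A) J"
  using assms by (auto simp: admissible_def)

lemma admissible_unique:
  assumes "admissible A J" "Backchain R P \<in> J" "Backchain R' P \<in> J"
  shows "R' = R"
proof -
  have "inj_on justified J"
    using assms(1) by (simp add: admissible_def)
  from inj_onD[OF this _ assms(2,3)] show ?thesis
    by simp
qed

lemma admissible_reach:
  "admissible A J \<Longrightarrow> reach (goals A) J \<subseteq> potentials A"
  by (rule reach_mono) (auto simp: admissible_def all_backchains_def)

lemma admissible_finite:
  assumes "abduction_instance A" "admissible A J"
  shows "finite J"
proof -
  have "justified ` J \<subseteq> potentials A"
    using assms(2) admissible_reach[OF assms(2)] by (fastforce simp: admissible_def)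
  then have "finite (justified ` J)"
    using finite_potentials[OF assms(1)] finite_subset by blast
  then show ?thesis
    using assms(2) finite_imageD by (auto simp: admissible_def)
qed

text \<open>Each edge comes from an operation, and consecutive operations are linked by
  \<open>feeds\<close>. On a closed path the operations at the two ends justify the same fact, so by
  uniqueness their axioms coincide and close a cycle in \<open>feeds\<close>.\<close>

lemma admissible_acyclic:
  assumes A: "abduction_instance A" and J: "admissible A J"
  shows "acyclic (\<Union>s \<in> J. induced_edges s)"
proof (rule acyclicI, rule allI, rule notI)
  let ?E = "\<Union>s \<in> J. induced_edges s"
  have edge: "\<exists>R. Backchain R P \<in> J \<and> Q \<in> needs R P" if "(Q, P) \<in> ?E" for P Q
  proof -
    obtain s where "s \<in> J" "(Q, P) \<in> induced_edges s"
      using \<open>(Q, P) \<in> ?E\<close> by blast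
    moreover from this J obtain R P' where "s = Backchain R P'"
      unfolding admissible_def by blast
    ultimately show ?thesis
      by auto
  qed
  \<comment> \<open>Edges point from a needed fact to the fact it supports, so the chain in
    \<open>feeds\<close> runs against the path.\<close>
  have path: "\<exists>R. Backchain R P \<in> J \<and> (R, R') \<in> (feeds (axioms A))\<^sup>+"
    if "(Q, P) \<in> ?E\<^sup>+" "Backchain R' Q \<in> J" for P Q R'
    using that(1)
  proof induction
    case (base P)
    then obtain R where "Backchain R P \<in> J" "Q \<in> needs R P"
      using edge by metis
    then show ?case
      using needs_feeds admissibleD[OF J] that(2) by (metis r_into_trancl')
  next
    case (step P P')
    then obtain R where R: "Backchain R P \<in> J" "(R, R') \<in> (feeds (axioms A))\<^sup>+"
      by blast
    obtain R2 where R2: "Backchain R2 P' \<in> J" "P \<in> needs R2 P'"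
      using edge step.hyps(2) by metis
    have "(R2, R) \<in> feeds (axioms A)"
      using R R2 admissibleD[OF J] needs_feeds by metis
    then show ?case
      using R R2 by (blast intro: trancl_into_trancl2)
  qed
  fix P assume P: "(P, P) \<in> ?E\<^sup>+"
  then obtain R where R: "Backchain R P \<in> J"
    using edge tranclD2 by metis
  then obtain R' where "Backchain R' P \<in> J" "(R', R) \<in> (feeds (axioms A))\<^sup>+"
    using path P by blast
  then have "(R, R) \<in> (feeds (axioms A))\<^sup>+"
    using R admissible_unique[OF J] by blast
  then show False
    using A by (auto simp: abduction_instance_def acyclic_def)
qed

text \<open>The second conjunct supports the induction for the first: an old operation applies only
  to a fact that was already reached, so after adding \<open>needs R P\<close> no old operation
  contributes anything new.\<close>

lemma derivation_backchaining:
  assumes "derivation A H J" "J \<subseteq> {Backchain R P | R P. True}"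
  shows "{P. Holds P \<in> H} = reach (goals A) J \<and>
    J \<subseteq> {Backchain R P | R P. R \<in> axioms A \<and> applicable R P \<and> P \<in> reach (goals A) J}"
  using assms
proof induction
  case 1
  have "reach (goals A) {} \<subseteq> goals A"
    by (rule reach_least) auto
  then show ?case
    by (auto intro: reach.start)
next
  case (2 H J s H')
  then obtain R P where s: "s = Backchain R P"
    by auto
  with 2 have step: "P \<in> reach (goals A) J" "R \<in> axioms A" "applicable R P"
    "H' = H \<union> Holds ` needs R P"
    by (auto elim: step.cases)
  let ?J = "insert s J"
  have IH: "{P. Holds P \<in> H} = reach (goals A) J"
    "J \<subseteq> {Backchain R P | R P. R \<in> axioms A \<and> applicable R P \<and> P \<in> reach (goals A) J}"
    using 2 by auto
  have mono: "reach (goals A) J \<subseteq> reach (goals A) ?J"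
    by (rule reach_mono) blast
  have "reach (goals A) ?J \<subseteq> reach (goals A) J \<union> needs R P"
    using IH(2) s by (intro reach_least) (auto intro: reach.intros)
  moreover have "needs R P \<subseteq> reach (goals A) ?J"
    using step(1) mono s by (blast intro: reach.need)
  ultimately have "reach (goals A) ?J = reach (goals A) J \<union> needs R P"
    using mono by blast
  moreover have "{P. Holds P \<in> H'} = {P. Holds P \<in> H} \<union> needs R P"
    unfolding step(4) by auto
  ultimately have "{P. Holds P \<in> H'} = reach (goals A) ?J"
    using IH(1) by simp
  moreover have "?J \<subseteq> {Backchain R P | R P. R \<in> axioms A \<and> applicable R P \<and> P \<in> reach (goals A) ?J}"
    using IH(2) step(1-3) mono s by blast
  ultimately show ?case
    by simp
qed

text \<open>A maximal derivable subset of \<open>J\<close> replaces an explicit ordering: a missing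
  operation of \<open>J\<close> on a reached fact could be appended, so the subset reaches
  everything that \<open>J\<close> reaches and hence contains \<open>J\<close>.\<close>

lemma admissible_derivation:
  assumes A: "abduction_instance A" and J: "admissible A J"
  shows "\<exists>H. derivation A H J"
proof -
  let ?D = "{J'. J' \<subseteq> J \<and> (\<exists>H. derivation A H J')}"
  have "finite ?D"
    using admissible_finite[OF A J] by simp
  moreover have "{} \<in> ?D"
    by (auto intro: derivation.intros)
  ultimately have "\<exists>J' \<in> ?D. \<forall>K \<in> ?D. J' \<subseteq> K \<longrightarrow> J' = K"
    by (intro finite_has_maximal) auto
  then obtain J' where J': "J' \<in> ?D" and max: "\<forall>K \<in> ?D. J' \<subseteq> K \<longrightarrow> J' = K"
    by (elim bexE)
  then obtain H where H: "derivation A H J'"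
    by blast
  have "J' \<subseteq> {Backchain R P | R P. True}"
    using J J' by (auto simp: admissible_def)
  with H have facts: "{P. Holds P \<in> H} = reach (goals A) J'"
    using derivation_backchaining by blast
  have closed: "Backchain R P \<in> J'" if "Backchain R P \<in> J" "P \<in> reach (goals A) J'" for R P
  proof -
    have "derivation A (H \<union> Holds ` needs R P) (insert (Backchain R P) J')"
      using that facts admissibleD[OF J that(1)] H by (blast intro: derivation.intros step.intros)
    then have "insert (Backchain R P) J' \<in> ?D"
      using that J' by blast
    from bspec[OF max this] show ?thesis
      by blast
  qed
  have "reach (goals A) J \<subseteq> reach (goals A) J'"
    using closed by (intro reach_least) (auto intro: reach.intros)
  then have "J \<subseteq> J'"
    using closed J by (fastforce simp: admissible_def)
  with J' have "J' = J"
    by blast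
  then show ?thesis
    using H by blast
qed

definition graph_of :: "abduction \<Rightarrow> inference set \<Rightarrow> proof_graph" where
  "graph_of A J =
     \<lparr>nodes = reach (goals A) J, edges = (\<Union>s \<in> J. induced_edges s), inferences = J\<rparr>"

text \<open>By \<open>derivation_backchaining\<close> the nodes are a function of the operations,
  and the edges are so by definition; the order of the derivation leaves no trace in the
  graph.\<close>

lemma backchaining_proof_graphs:
  assumes A: "abduction_instance A"
  shows "{G. \<exists>H \<in> hypotheses A. is_proof_graph A H G \<and> via_backchaining G} =
    graph_of A ` {J. admissible A J}"
proof (intro set_eqI iffI)
  fix G assume "G \<in> {G. \<exists>H \<in> hypotheses A. is_proof_graph A H G \<and> via_backchaining G}"
  then obtain H where H: "is_proof_graph A H G" "via_backchaining G"
    by blast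
  then have "derivation A H (inferences G)" "inferences G \<subseteq> {Backchain R P | R P. True}"
    by (simp_all add: is_proof_graph_def via_backchaining_def)
  from derivation_backchaining[OF this] H(1)
  have "admissible A (inferences G)" "G = graph_of A (inferences G)"
    by (simp_all add: is_proof_graph_def admissible_def graph_of_def)
  then show "G \<in> graph_of A ` {J. admissible A J}"
    by blast
next
  fix G assume "G \<in> graph_of A ` {J. admissible A J}"
  then obtain J where J: "admissible A J" and G: "G = graph_of A J"
    by blast
  obtain H where H: "derivation A H J"
    using admissible_derivation[OF A J] by blast
  have via: "J \<subseteq> {Backchain R P | R P. True}"
    using J by (auto simp: admissible_def)
  have "is_proof_graph A H G"
    using H derivation_backchaining[OF H via] admissible_acyclic[OF A J] J G
    by (simp add: is_proof_graph_def graph_of_def admissible_def)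
  moreover have "via_backchaining G"
    using via G by (simp add: via_backchaining_def graph_of_def)
  moreover have "H \<in> hypotheses A"
    using H hypotheses_iff_derivation by blast
  ultimately show "G \<in> {G. \<exists>H \<in> hypotheses A. is_proof_graph A H G \<and> via_backchaining G}"
    by blast
qed

section \<open>The term encoding\<close>

text \<open>A constant named \<open>s\<close> cannot clash with a Skolem term: its encoding has
  arity 0, that of a Skolem term has at least two arguments.\<close>

lemma enc_trm_inject [simp]: "enc_trm s = enc_trm t \<longleftrightarrow> s = t"
proof (induction s arbitrary: t)
  case (Cst c)
  then show ?case
    by (cases t) auto
next
  case (Skolem a i ts)
  have "map enc_trm ts = map enc_trm us \<longleftrightarrow> ts = us" for us
    using Skolem by (induction ts arbitrary: us) (auto simp: Cons_eq_map_conv map_eq_Cons_conv)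
  then show ?case
    by (cases t) auto
qed

lemma inj_enc_trm: "inj enc_trm"
  by (simp add: inj_def)

lemma enc_fact_inject [simp]: "enc_fact P = enc_fact Q \<longleftrightarrow> P = Q"
  using inj_enc_trm by (cases P; cases Q) (auto simp: enc_fact_def inj_map_eq_map)

lemma subst_enc_trm [simp]: "subst \<sigma> (enc_trm t) = enc_trm t"
  by (induction t) auto

lemma subst_enc_fact [simp]: "subst \<sigma> (enc_fact P) = enc_fact P"
  by (cases P) (auto simp: enc_fact_def)

lemma vars_enc_fact [simp]: "vars (enc_fact P) = {}"
proof -
  have "vars (enc_trm t) = {}" for t
    by (induction t) auto
  then show ?thesis
    by (simp add: enc_fact_def)
qed

lemma subst_enc_pattern: "subst (enc_trm \<circ> \<theta>) (enc_pattern p) = enc_fact (inst \<theta> p)"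
proof -
  have "subst (enc_trm \<circ> \<theta>) (enc_arg a) = enc_trm (inst_arg \<theta> a)" for a
    by (cases a) auto
  then show ?thesis
    by (cases p) (auto simp: enc_pattern_def enc_fact_def inst_def)
qed

lemma subst_enc_pattern_cong:
  assumes "\<forall>x \<in> set (atom_vars p). \<sigma> x = \<tau> x"
  shows "subst \<sigma> (enc_pattern p) = subst \<tau> (enc_pattern p)"
proof -
  have "subst \<sigma> (enc_arg a) = subst \<tau> (enc_arg a)" if "a \<in> set (args p)" for a
    using assms that by (cases a) (force simp: atom_vars_def)+
  then show ?thesis
    by (simp add: enc_pattern_def)
qed

text \<open>A converse to \<open>subst_enc_pattern\<close>: matching against an encoded fact gives
  the variables of the pattern only encoded terms as values, hence a match on the side of
  abduction.\<close>

lemma match_enc_pattern: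
  assumes "subst \<sigma> (enc_pattern p) = enc_fact P"
  obtains \<theta> where "inst \<theta> p = P" "\<forall>x \<in> set (atom_vars p). \<sigma> x = enc_trm (\<theta> x)"
proof -
  \<comment> \<open>Decoding by \<open>inv enc_trm\<close> is meaningful on the variables of
    \<open>p\<close>, where the match forces encoded values.\<close>
  define \<theta> where "\<theta> = inv enc_trm \<circ> \<sigma>"
  have pred: "pred p = pred P" and args: "map (subst \<sigma> \<circ> enc_arg) (args p) = map enc_trm (args P)"
    using assms by (simp_all add: enc_pattern_def enc_fact_def)
  have arg: "inst_arg \<theta> a = t \<and> (\<forall>x \<in> set (arg_vars a). \<sigma> x = enc_trm (\<theta> x))"
    if "subst \<sigma> (enc_arg a) = enc_trm t" for a t
  proof (cases a)
    case (Var x)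
    then show ?thesis
      using that inj_enc_trm by (simp add: \<theta>_def)
  next
    case (Const c)
    then show ?thesis
      using that by (cases t) auto
  qed
  have len: "length (args p) = length (args P)"
    using args map_eq_imp_length_eq by blast
  have nth: "subst \<sigma> (enc_arg (args p ! i)) = enc_trm (args P ! i)" if "i < length (args p)" for i
    using arg_cong[OF args, of "\<lambda>xs. xs ! i"] that len by simp
  have "map (inst_arg \<theta>) (args p) = args P"
    using arg nth len by (intro nth_equalityI) auto
  then have "inst \<theta> p = P"
    using pred by (cases p; cases P) (simp add: inst_def)
  moreover have "\<forall>x \<in> set (atom_vars p). \<sigma> x = enc_trm (\<theta> x)"
    using arg nth by (fastforce simp: atom_vars_def in_set_conv_nth[of _ "args p"])
  ultimately show ?thesis
    using that by blast
qed


section \<open>The Herbrand universe\<close>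

lemma vars_subst: "vars (subst \<sigma> t) = (\<Union>x \<in> vars t. vars (\<sigma> x))"
  by (induction t) auto

lemma symbols_subst: "symbols (subst \<sigma> t) = symbols t \<union> (\<Union>x \<in> vars t. symbols (\<sigma> x))"
  by (induction t) auto

text \<open>The universe is given by symbols with arities, so a term is placed in it by exhibiting a
  rule in which a pattern for it occurs.\<close>

lemma subst_in_herbrand_universe:
  assumes "r \<in> P" "t \<in> rule_terms r" "\<And>x. x \<in> vars t \<Longrightarrow> \<sigma> x \<in> herbrand_universe P"
  shows "subst \<sigma> t \<in> herbrand_universe P"
  using assms by (auto simp: herbrand_universe_def vars_subst symbols_subst) fast+

lemma herbrand_universe_args:
  "AFun f ts \<in> herbrand_universe P \<Longrightarrow> t \<in> set ts \<Longrightarrow> t \<in> herbrand_universe P"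
  by (auto simp: herbrand_universe_def)

lemma num_in_herbrand_universe: "ANum n \<in> herbrand_universe P"
  by (simp add: herbrand_universe_def)

text \<open>Integers always belong to the universe, so 0 is a default value for the variables that
  do not occur in the rule at hand.\<close>

lemma groundings_ne: "(\<lambda>_. ANum 0) \<in> groundings P"
  by (auto simp: groundings_def num_in_herbrand_universe)

lemma groundings_upd:
  "\<sigma> \<in> groundings P \<Longrightarrow> t \<in> herbrand_universe P \<Longrightarrow> \<sigma>(x := t) \<in> groundings P"
  by (auto simp: groundings_def)

abbreviation program :: "abduction \<Rightarrow> prog" where
  "program A \<equiv> P_bpt A \<union> P_gp"

lemma goal_rule: "P \<in> goals A \<Longrightarrow> Disj [Atom ''goal'' [enc_fact P]] [] \<in> program A"
  by (auto simp: P_bpt_def)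

lemma may_infer_via_rule_in: "R \<in> axioms A \<Longrightarrow> may_infer_via_rule R \<in> program A"
  by (auto simp: P_bpt_def)

lemma inference_needs_rule_in:
  "R \<in> axioms A \<Longrightarrow> p \<in> set (body R) \<Longrightarrow> inference_needs_rule R p \<in> program A"
  by (auto simp: P_bpt_def)

text \<open>
  Groundings range over the Herbrand universe for all variables, so a matching substitution has to
  be defined outside the head variables, too; the predicate of \<open>P\<close> is a constant of the universe.
\<close>

lemma grounding_of_match:
  assumes R: "R \<in> axioms A" and P: "enc_fact P \<in> herbrand_universe (program A)"
    and app: "applicable R P"
  obtains \<theta> where "inst \<theta> (head R) = P" "enc_trm \<circ> skolemize R \<theta> \<in> groundings (program A)"
proof -
  let ?HU = "herbrand_universe (program A)"
  obtain \<theta>' where \<theta>': "inst \<theta>' (head R) = P"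
    using app by (auto simp: applicable_def)
  define \<theta> where "\<theta> x = (if x \<in> set (head_vars R) then \<theta>' x else Cst (pred P))" for x
  have \<theta>: "inst \<theta> (head R) = P"
    using \<theta>' inst_eq_iff[of \<theta> "head R" \<theta>'] by (simp add: \<theta>_def head_vars_def)
  have args: "t \<in> ?HU" if "t \<in> insert (AFun (pred P) []) (enc_trm ` set (args P))" for t
    using P that by (auto simp: enc_fact_def intro: herbrand_universe_args)
  have head: "enc_trm (\<theta> x) \<in> ?HU" if x: "x \<in> set (head_vars R)" for x
  proof -
    obtain a where a: "a \<in> set (args (head R))" "x \<in> set (arg_vars a)"
      using x by (auto simp: head_vars_def atom_vars_def)
    from a(2) have "a = Var x"
      by (cases a) simp_all
    then have "\<theta> x \<in> inst_arg \<theta> ` set (args (head R))"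
      using a(1) by force
    then have "\<theta> x \<in> set (args P)"
      unfolding \<theta>[symmetric] by (cases "head R") (simp add: inst_def)
    then show ?thesis
      using args by blast
  qed
  have default: "enc_trm (\<theta> x) \<in> ?HU" if "x \<notin> set (head_vars R)" for x
    using that args by (simp add: \<theta>_def)
  have "enc_trm (skolemize R \<theta> x) \<in> ?HU" for x
  proof (cases "x \<in> set (ex_vars R)")
    case True
    then obtain i where i: "(x, i) \<in> set (numbered_ex_vars R)"
      using ex_vars_numbered by blast
    \<comment> \<open>The equations of the rule contain this very pattern, so the symbol
      \<open>s\<close> is available with the arity that the Skolem term has.\<close>
    let ?t = "AFun ''s'' (AFun (ident R) [] # ANum (int i) # map AVar (head_vars R))"
    have "?t \<in> rule_terms (may_infer_via_rule R)"
      using i by (force simp: may_infer_via_rule_def)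
    then have "subst (enc_trm \<circ> \<theta>) ?t \<in> ?HU"
      using R head by (intro subst_in_herbrand_universe[OF may_infer_via_rule_in]) auto
    then show ?thesis
      by (simp add: skolemize_ex[OF i] comp_def)
  next
    case False
    then have "skolemize R \<theta> x = \<theta> x"
      using numbered_ex_varsD[of x] by (auto simp: skolemize_def split: option.split dest: map_of_SomeD)
    then show ?thesis
      using head default by metis
  qed
  then have "enc_trm \<circ> skolemize R \<theta> \<in> groundings (program A)"
    by (auto simp: groundings_def)
  then show ?thesis
    using that \<theta> by blast
qed

text \<open>This is what allows rules to fire on every potential fact. A needed fact lies in the
  universe as an instance of a pattern in an \<open>inference_needs_rule\<close>.\<close>

lemma enc_fact_in_herbrand_universe:
  assumes "P \<in> potentials A"
  shows "enc_fact P \<in> herbrand_universe (program A)"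
  using assms
proof induction
  case (start P)
  have "subst enc (enc_fact P) \<in> herbrand_universe (program A)" for enc
    by (rule subst_in_herbrand_universe[OF goal_rule[OF start]]) auto
  then show ?case
    by simp
next
  case (need P R Q)
  then have R: "R \<in> axioms A"
    by (simp add: all_backchains_def)
  then obtain \<theta> where \<theta>: "inst \<theta> (head R) = P" "enc_trm \<circ> skolemize R \<theta> \<in> groundings (program A)"
    using grounding_of_match need needs_applicable by metis
  then obtain p where p: "p \<in> set (body R)" "Q = inst (skolemize R \<theta>) p"
    using need by (auto simp: needs_eq)
  have "subst (enc_trm \<circ> skolemize R \<theta>) (enc_pattern p) \<in> herbrand_universe (program A)"
    using \<theta>(2) by (intro subst_in_herbrand_universe[OF inference_needs_rule_in[OF R p(1)]])
      (auto simp: inference_needs_rule_def groundings_def)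
  then show ?case
    by (simp add: subst_enc_pattern p(2))
qed

lemma inst_head_skolemize: "inst (skolemize R \<theta>) (head R) = inst \<theta> (head R)"
  using skolemize_head by (simp add: inst_eq_iff head_vars_def)

definition skolem_list :: "axiom \<Rightarrow> (string \<Rightarrow> trm) \<Rightarrow> aterm" where
  "skolem_list R \<theta> = AFun ''l'' (map (enc_trm \<circ> skolemize R \<theta>) (ex_vars R))"

text \<open>Lets an arbitrary match be exchanged for the one supplied by
  \<open>grounding_of_match\<close>.\<close>

lemma skolem_list_cong:
  "inst \<theta> (head R) = inst \<theta>' (head R) \<Longrightarrow> skolem_list R \<theta> = skolem_list R \<theta>'"
  using skolemize_cong[of R \<theta> \<theta>']
  by (simp add: skolem_list_def set_ex_vars head_vars_def inst_eq_iff)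

lemma ident_in_herbrand_universe:
  assumes "R \<in> axioms A"
  shows "AFun (ident R) [] \<in> herbrand_universe (program A)"
proof -
  have "subst (\<lambda>_. ANum 0) (AFun (ident R) []) \<in> herbrand_universe (program A)"
    by (rule subst_in_herbrand_universe[OF may_infer_via_rule_in[OF assms]])
      (auto simp: may_infer_via_rule_def may_infer_via_atom_def)
  then show ?thesis
    by simp
qed

lemma skolem_list_in_herbrand_universe:
  assumes R: "R \<in> axioms A" and P: "inst \<theta> (head R) \<in> potentials A"
  shows "skolem_list R \<theta> \<in> herbrand_universe (program A)"
proof -
  have "applicable R (inst \<theta> (head R))"
    by (auto simp: applicable_def)
  then obtain \<theta>' where \<theta>': "inst \<theta>' (head R) = inst \<theta> (head R)"
    and \<sigma>: "enc_trm \<circ> skolemize R \<theta>' \<in> groundings (program A)"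
    using grounding_of_match[OF R enc_fact_in_herbrand_universe[OF P]] by metis
  have "subst (enc_trm \<circ> skolemize R \<theta>') (AFun ''l'' (map AVar (ex_vars R)))
      \<in> herbrand_universe (program A)"
    by (rule subst_in_herbrand_universe[OF may_infer_via_rule_in[OF R]])
      (use \<sigma> in \<open>auto simp: may_infer_via_rule_def may_infer_via_atom_def groundings_def\<close>)
  moreover have "skolem_list R \<theta> = skolem_list R \<theta>'"
    using \<theta>' by (intro skolem_list_cong) simp
  ultimately show ?thesis
    by (simp only: skolem_list_def subst.simps list.map_comp comp_def)
qed

lemma subst_may_infer_via_atom:
  "subst_atom (enc_trm \<circ> skolemize R \<theta>) (may_infer_via_atom R) =
     Atom ''mayInferVia'' [AFun (ident R) [], enc_fact (inst \<theta> (head R)), skolem_list R \<theta>]"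
  by (simp add: may_infer_via_atom_def skolem_list_def subst_enc_pattern inst_head_skolemize)

text \<open>
  The equations in the body of a \<open>mayInferVia\<close> rule force the grounding to be the Skolemized match.
\<close>

lemma grounding_is_skolemize:
  assumes "\<forall>x \<in> set (head_vars R). \<sigma> x = enc_trm (\<theta> x)"
    and "\<forall>x \<in> set (ex_vars R). \<sigma> x = enc_trm (skolemize R \<theta> x)"
    and "x \<in> set (head_vars R) \<union> set (body_vars R)"
  shows "\<sigma> x = (enc_trm \<circ> skolemize R \<theta>) x"
  using assms by (cases "x \<in> set (head_vars R)") (auto simp: skolemize_head set_ex_vars)

section \<open>The atoms of answer sets\<close>

text \<open>The part that all answer sets share. \<open>P_bpt_head\<close> shows that
  \<open>P_bpt\<close> derives nothing beyond it, \<open>base_fires\<close> that models of the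
  reduct contain it.\<close>

definition base :: "abduction \<Rightarrow> aatom set" where
  "base A =
     {Atom ''goal'' [enc_fact P] | P. P \<in> goals A} \<union>
     {Atom ''sortname'' [AFun s []] | s. s \<in> sorts A} \<union>
     {Atom ''pot'' [enc_fact P] | P. P \<in> potentials A} \<union>
     {Atom ''mayInferVia'' [AFun (ident R) [], enc_fact (inst \<theta> (head R)), skolem_list R \<theta>]
        | R \<theta>. R \<in> axioms A \<and> inst \<theta> (head R) \<in> potentials A} \<union>
     {Atom ''inferenceNeeds'' [enc_fact P, AFun (ident R) [], enc_fact Q]
        | R P Q. R \<in> axioms A \<and> P \<in> potentials A \<and> Q \<in> needs R P}"

definition encoding :: "abduction \<Rightarrow> inference set \<Rightarrow> aatom set" where
  "encoding A J =
     base A \<union>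
     {Atom ''true'' [enc_fact P] | P. P \<in> reach (goals A) J} \<union>
     {Atom ''infer'' [enc_fact P] | R P. Backchain R P \<in> J} \<union>
     {Atom ''fai'' [enc_fact P] | P. P \<in> reach (goals A) J \<and> (\<forall>R. Backchain R P \<notin> J)} \<union>
     {Atom ''inferVia'' [AFun (ident R) [], enc_fact P] | R P. Backchain R P \<in> J}"

text \<open>
  An upper bound on the atoms that are derivable when the true facts are among \<open>N\<close> and the
  inferred facts among \<open>M\<close>.
\<close>

definition envelope :: "abduction \<Rightarrow> fact set \<Rightarrow> fact set \<Rightarrow> aatom set" where
  "envelope A N M =
     base A \<union>
     {Atom ''true'' [enc_fact P] | P. P \<in> N} \<union>
     {Atom ''infer'' [enc_fact P] | P. P \<in> M} \<union>
     {Atom ''fai'' [enc_fact P] | P. P \<in> N} \<union>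
     {Atom ''inferVia'' [AFun (ident R) [], enc_fact P] | R P. R \<in> axioms A \<and> applicable R P \<and> P \<in> M}"

lemma base_simps [simp]:
  "Atom ''goal'' ts \<in> base A \<longleftrightarrow> (\<exists>P \<in> goals A. ts = [enc_fact P])"
  "Atom ''pot'' ts \<in> base A \<longleftrightarrow> (\<exists>P \<in> potentials A. ts = [enc_fact P])"
  "Atom ''mayInferVia'' ts \<in> base A \<longleftrightarrow>
     (\<exists>R \<theta>. R \<in> axioms A \<and> inst \<theta> (head R) \<in> potentials A \<and>
        ts = [AFun (ident R) [], enc_fact (inst \<theta> (head R)), skolem_list R \<theta>])"
  "Atom ''inferenceNeeds'' ts \<in> base A \<longleftrightarrow>
     (\<exists>R P Q. R \<in> axioms A \<and> P \<in> potentials A \<and> Q \<in> needs R P \<and>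
        ts = [enc_fact P, AFun (ident R) [], enc_fact Q])"
  "Atom ''true'' ts \<notin> base A"
  "Atom ''infer'' ts \<notin> base A"
  "Atom ''fai'' ts \<notin> base A"
  "Atom ''inferVia'' ts \<notin> base A"
  by (auto simp: base_def)

lemma envelope_simps [simp]:
  "Atom ''goal'' ts \<in> envelope A N M \<longleftrightarrow> Atom ''goal'' ts \<in> base A"
  "Atom ''pot'' ts \<in> envelope A N M \<longleftrightarrow> Atom ''pot'' ts \<in> base A"
  "Atom ''mayInferVia'' ts \<in> envelope A N M \<longleftrightarrow> Atom ''mayInferVia'' ts \<in> base A"
  "Atom ''inferenceNeeds'' ts \<in> envelope A N M \<longleftrightarrow> Atom ''inferenceNeeds'' ts \<in> base A"
  "Atom ''true'' ts \<in> envelope A N M \<longleftrightarrow> (\<exists>P \<in> N. ts = [enc_fact P])"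
  "Atom ''infer'' ts \<in> envelope A N M \<longleftrightarrow> (\<exists>P \<in> M. ts = [enc_fact P])"
  "Atom ''fai'' ts \<in> envelope A N M \<longleftrightarrow> (\<exists>P \<in> N. ts = [enc_fact P])"
  "Atom ''inferVia'' ts \<in> envelope A N M \<longleftrightarrow>
     (\<exists>R \<in> axioms A. \<exists>P \<in> M. applicable R P \<and> ts = [AFun (ident R) [], enc_fact P])"
  by (simp_all add: envelope_def del: base_simps(1-4)) blast+

lemma encoding_simps [simp]:
  "Atom ''goal'' ts \<in> encoding A J \<longleftrightarrow> Atom ''goal'' ts \<in> base A"
  "Atom ''pot'' ts \<in> encoding A J \<longleftrightarrow> Atom ''pot'' ts \<in> base A"
  "Atom ''mayInferVia'' ts \<in> encoding A J \<longleftrightarrow> Atom ''mayInferVia'' ts \<in> base A"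
  "Atom ''inferenceNeeds'' ts \<in> encoding A J \<longleftrightarrow> Atom ''inferenceNeeds'' ts \<in> base A"
  "Atom ''true'' ts \<in> encoding A J \<longleftrightarrow> (\<exists>P \<in> reach (goals A) J. ts = [enc_fact P])"
  "Atom ''infer'' ts \<in> encoding A J \<longleftrightarrow> (\<exists>R P. Backchain R P \<in> J \<and> ts = [enc_fact P])"
  "Atom ''fai'' ts \<in> encoding A J \<longleftrightarrow>
     (\<exists>P \<in> reach (goals A) J. (\<forall>R. Backchain R P \<notin> J) \<and> ts = [enc_fact P])"
  "Atom ''inferVia'' ts \<in> encoding A J \<longleftrightarrow>
     (\<exists>R P. Backchain R P \<in> J \<and> ts = [AFun (ident R) [], enc_fact P])"
  by (simp_all add: encoding_def del: base_simps(1-4)) blast+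

lemma ident_eq_iff:
  "abduction_instance A \<Longrightarrow> R \<in> axioms A \<Longrightarrow> R' \<in> axioms A \<Longrightarrow> ident R = ident R' \<longleftrightarrow> R = R'"
  by (auto simp: abduction_instance_def inj_on_eq_iff)

lemma subst_may_infer_via_atom_cong:
  assumes "\<And>x. x \<in> set (head_vars R) \<union> set (body_vars R) \<Longrightarrow> \<sigma> x = \<tau> x"
  shows "subst_atom \<sigma> (may_infer_via_atom R) = subst_atom \<tau> (may_infer_via_atom R)"
  using assms subst_enc_pattern_cong[of "head R" \<sigma> \<tau>]
  by (simp add: may_infer_via_atom_def head_vars_def set_ex_vars)

text \<open>Matching the \<open>pot\<close> atom fixes the head variables, and the equations fix the
  remaining ones from them.\<close>

lemma may_infer_via_head:
  assumes R: "R \<in> axioms A" and Z: "{a. Plain a \<in> Z} \<subseteq> envelope A N M"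
    and body: "sats Z \<sigma> (Pos (Atom ''pot'' [enc_pattern (head R)]) #
        map (\<lambda>(z, i). Eq (AVar z)
               (AFun ''s'' (AFun (ident R) [] # ANum (int i) # map AVar (head_vars R))))
          (numbered_ex_vars R))"
  shows "subst_atom \<sigma> (may_infer_via_atom R) \<in> base A"
proof -
  have "Atom ''pot'' [subst \<sigma> (enc_pattern (head R))] \<in> envelope A N M"
    using body Z by (auto simp: sats_def)
  then obtain P where P: "P \<in> potentials A" "subst \<sigma> (enc_pattern (head R)) = enc_fact P"
    by auto
  then obtain \<theta> where \<theta>: "inst \<theta> (head R) = P" "\<forall>x \<in> set (head_vars R). \<sigma> x = enc_trm (\<theta> x)"
    unfolding head_vars_def by (metis match_enc_pattern)
  have "\<sigma> z = enc_trm (skolemize R \<theta> z)" if "z \<in> set (ex_vars R)" for z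
  proof -
    obtain i where i: "(z, i) \<in> set (numbered_ex_vars R)"
      using \<open>z \<in> set (ex_vars R)\<close> ex_vars_numbered by blast
    have "sat Z (subst_lit \<sigma> (Eq (AVar z)
            (AFun ''s'' (AFun (ident R) [] # ANum (int i) # map AVar (head_vars R)))))"
      using body i by (force simp: sats_def)
    then show ?thesis
      using \<theta>(2) by (simp add: skolemize_ex[OF i] comp_def)
  qed
  then have "subst_atom \<sigma> (may_infer_via_atom R) =
      subst_atom (enc_trm \<circ> skolemize R \<theta>) (may_infer_via_atom R)"
    using \<theta>(2) grounding_is_skolemize by (intro subst_may_infer_via_atom_cong) blast
  then show ?thesis
    using R P(1) \<theta>(1) by (auto simp: subst_may_infer_via_atom)
qed

text \<open>This rule has no equations. The values of the existential variables are read off the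
  third argument of the \<open>mayInferVia\<close> atom, and unique identifiers tell which axiom
  produced that atom.\<close>

lemma inference_needs_head:
  assumes A: "abduction_instance A" and R: "R \<in> axioms A" and p: "p \<in> set (body R)"
    and Z: "{a. Plain a \<in> Z} \<subseteq> envelope A N M"
    and body: "sats Z \<sigma> [Pos (may_infer_via_atom R)]"
  shows "Atom ''inferenceNeeds''
    [subst \<sigma> (enc_pattern (head R)), AFun (ident R) [], subst \<sigma> (enc_pattern p)] \<in> base A"
proof -
  have "subst_atom \<sigma> (may_infer_via_atom R) \<in> envelope A N M"
    using body Z by (auto simp: sats_def)
  then obtain R' \<theta> where R': "R' \<in> axioms A" "ident R' = ident R" and P: "inst \<theta> (head R') \<in> potentials A"
    and head: "subst \<sigma> (enc_pattern (head R)) = enc_fact (inst \<theta> (head R'))"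
    and sk: "map \<sigma> (ex_vars R) = map (enc_trm \<circ> skolemize R' \<theta>) (ex_vars R')"
    by (auto simp: may_infer_via_atom_def skolem_list_def comp_def)
  have [simp]: "R' = R"
    using R R' ident_eq_iff[OF A] by blast
  obtain \<theta>' where \<theta>': "inst \<theta>' (head R) = inst \<theta> (head R)"
    "\<forall>x \<in> set (head_vars R). \<sigma> x = enc_trm (\<theta>' x)"
    using head unfolding head_vars_def by (metis match_enc_pattern \<open>R' = R\<close>)
  then have "\<forall>x \<in> set (head_vars R). \<sigma> x = enc_trm (\<theta> x)"
    by (simp add: inst_eq_iff head_vars_def)
  moreover have "\<forall>x \<in> set (ex_vars R). \<sigma> x = enc_trm (skolemize R \<theta> x)"
    using sk by simp
  ultimately have "\<sigma> x = (enc_trm \<circ> skolemize R \<theta>) x" if "x \<in> set (body_vars R)" for x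
    using that grounding_is_skolemize by blast
  then have "subst \<sigma> (enc_pattern p) = enc_fact (inst (skolemize R \<theta>) p)"
    using atom_vars_body[OF p] by (subst subst_enc_pattern[symmetric], intro subst_enc_pattern_cong) blast
  moreover have "inst (skolemize R \<theta>) p \<in> needs R (inst \<theta> (head R))"
    using p by (auto simp: needs_eq)
  ultimately show ?thesis
    using R P head by auto
qed

text \<open>\<open>N\<close> and \<open>M\<close> are left open because two interpretations are
  treated: the cut-down answer set and the one built from an admissible \<open>J\<close>.\<close>

lemma P_bpt_head:
  assumes A: "abduction_instance A" and Z: "{a. Plain a \<in> Z} \<subseteq> envelope A N M"
    and r: "r \<in> P_bpt A" "(h, b) \<in> ground_rules Pr r" "b Z"
  shows "\<exists>a \<in> base A. h = {Plain a}"
proof -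
  note pot_need = reach.need[where J = "all_backchains A" and S = "goals A"]
  consider P where "P \<in> goals A" "r = Disj [Atom ''goal'' [enc_fact P]] []"
    | s where "s \<in> sorts A" "r = Disj [Atom ''sortname'' [AFun s []]] []"
    | R where "R \<in> axioms A" "r = may_infer_via_rule R"
    | R p where "R \<in> axioms A" "p \<in> set (body R)" "r = inference_needs_rule R p"
    | "r = Disj [Atom ''pot'' [AVar ''X'']] [Pos (Atom ''goal'' [AVar ''X''])]"
    | "r = Disj [Atom ''pot'' [AVar ''P'']]
        [Pos (Atom ''inferenceNeeds'' [AVar ''_1'', AVar ''_2'', AVar ''P''])]"
    using r(1) unfolding P_bpt_def by blast
  then show ?thesis
  proof cases
    case 1
    then show ?thesis
      using r by auto
  next
    case 2
    then show ?thesis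
      using r by (auto simp: base_def)
  next
    case 3
    then show ?thesis
      using r may_infer_via_head[OF _ Z] by (auto simp: may_infer_via_rule_def)
  next
    case 4
    then show ?thesis
      using r inference_needs_head[OF A _ _ Z] by (auto simp: inference_needs_rule_def simp del: base_simps)
  next
    case 5
    then obtain \<sigma> where h: "h = {Plain (Atom ''pot'' [\<sigma> ''X''])}" "Plain (Atom ''goal'' [\<sigma> ''X'']) \<in> Z"
      using r by (auto simp: sats_def)
    then have "Atom ''goal'' [\<sigma> ''X''] \<in> envelope A N M"
      using Z by blast
    then show ?thesis
      using h by (auto intro: reach.start)
  next
    case 6
    then obtain \<sigma> where h: "h = {Plain (Atom ''pot'' [\<sigma> ''P''])}"
      "Plain (Atom ''inferenceNeeds'' [\<sigma> ''_1'', \<sigma> ''_2'', \<sigma> ''P'']) \<in> Z"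
      using r(2,3) by (auto simp: sats_def)
    then have "Atom ''inferenceNeeds'' [\<sigma> ''_1'', \<sigma> ''_2'', \<sigma> ''P''] \<in> envelope A N M"
      using Z by blast
    then obtain R P Q where "R \<in> axioms A" "P \<in> potentials A" "Q \<in> needs R P" "\<sigma> ''P'' = enc_fact Q"
      by auto
    moreover from this have "Q \<in> potentials A"
      using pot_need by (simp add: all_backchains_def)
    ultimately show ?thesis
      using h by simp
  qed
qed


section \<open>Models of the reduct\<close>

text \<open>Puts a rule whose body holds in \<open>Y\<close> into the reduct by a larger
  \<open>X\<close>.\<close>

lemma sats_mono:
  "sats Y \<sigma> b \<Longrightarrow> Y \<subseteq> X \<Longrightarrow> \<forall>l \<in> set b. \<forall>a. l \<noteq> Neg a \<Longrightarrow> sats X \<sigma> b"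
proof -
  assume *: "sats Y \<sigma> b" "Y \<subseteq> X" "\<forall>l \<in> set b. \<forall>a. l \<noteq> Neg a"
  have "sat X (subst_lit \<sigma> l)" if "l \<in> set b" for l
    using * that by (cases l) (fastforce simp: sats_def)+
  then show ?thesis
    by (simp add: sats_def)
qed

lemma pot_goal_rule:
  "Disj [Atom ''pot'' [AVar ''X'']] [Pos (Atom ''goal'' [AVar ''X''])] \<in> program A"
  by (simp add: P_bpt_def)

lemma pot_needs_rule:
  "Disj [Atom ''pot'' [AVar ''P'']]
     [Pos (Atom ''inferenceNeeds'' [AVar ''_1'', AVar ''_2'', AVar ''P''])] \<in> program A"
  by (simp add: P_bpt_def)

text \<open>Used with \<open>Y = X\<close> to read an answer set, and with \<open>Y\<close> an
  arbitrary submodel of \<open>extension A J\<close> for minimality.\<close>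

locale reduct_model =
  fixes A :: abduction and X Y :: interp
  assumes A: "abduction_instance A" and subset: "Y \<subseteq> X"
    and model: "model (reduct (ground (program A)) X) Y"
begin

lemma disj_fires:
  assumes "Disj [h] b \<in> program A" "\<sigma> \<in> groundings (program A)" "sats Y \<sigma> b"
    "\<forall>l \<in> set b. \<forall>a. l \<noteq> Neg a"
  shows "Plain (subst_atom \<sigma> h) \<in> Y"
proof -
  have "({Plain (subst_atom \<sigma> h)}, \<lambda>X. sats X \<sigma> b) \<in> ground (program A)"
    unfolding ground_def using assms(1,2) by (force intro!: bexI[of _ "Disj [h] b"])
  moreover have "sats X \<sigma> b"
    using assms(3,4) subset sats_mono by blast
  ultimately show ?thesis
    using model assms(3) by (fastforce simp: model_def reduct_def)
qed

lemma choice_fires: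
  assumes "Choice l es u b \<in> program A" "(a, ls) \<in> set es" "\<sigma> \<in> groundings (program A)"
    "sats Y \<sigma> b" "sats Y \<sigma> ls"
    "\<forall>l \<in> set b. \<forall>a. l \<noteq> Neg a" "\<forall>l \<in> set ls. \<forall>a. l \<noteq> Neg a"
  shows "Plain (subst_atom \<sigma> a) \<in> Y \<or> Hat (subst_atom \<sigma> a) \<in> Y"
proof -
  have "({Plain (subst_atom \<sigma> a), Hat (subst_atom \<sigma> a)}, \<lambda>X. sats X \<sigma> b \<and> sats X \<sigma> ls)
      \<in> ground_rules (program A) (Choice l es u b)"
    using assms(2,3) by auto
  then have "({Plain (subst_atom \<sigma> a), Hat (subst_atom \<sigma> a)}, \<lambda>X. sats X \<sigma> b \<and> sats X \<sigma> ls)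
      \<in> ground (program A)"
    unfolding ground_def using assms(1) by blast
  moreover have "sats X \<sigma> b" "sats X \<sigma> ls"
    using assms(4-7) subset sats_mono by blast+
  ultimately show ?thesis
    using model assms(4,5) by (fastforce simp: model_def reduct_def)
qed

lemma goal_fires: "P \<in> goals A \<Longrightarrow> Plain (Atom ''goal'' [enc_fact P]) \<in> Y"
  using disj_fires[OF goal_rule groundings_ne] by (simp add: sats_def)

text \<open>The \<open>pot\<close> atom is assumed because \<open>pot_fires\<close> applies this
  lemma inside its own induction, along the loop from \<open>pot\<close> over
  \<open>mayInferVia\<close> and \<open>inferenceNeeds\<close> back to \<open>pot\<close>.\<close>

lemma may_infer_via_fires:
  assumes R: "R \<in> axioms A" and P: "P \<in> potentials A" "inst \<theta> (head R) = P"
    and pot: "Plain (Atom ''pot'' [enc_fact P]) \<in> Y"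
  shows "Plain (Atom ''mayInferVia'' [AFun (ident R) [], enc_fact P, skolem_list R \<theta>]) \<in> Y"
    and "Q \<in> needs R P \<Longrightarrow> Plain (Atom ''inferenceNeeds'' [enc_fact P, AFun (ident R) [], enc_fact Q]) \<in> Y"
proof -
  have "applicable R P"
    using P by (auto simp: applicable_def)
  then obtain \<theta>' where \<theta>': "inst \<theta>' (head R) = P"
    and \<sigma>: "enc_trm \<circ> skolemize R \<theta>' \<in> groundings (program A)"
    using grounding_of_match[OF R enc_fact_in_herbrand_universe[OF P(1)]] by metis
  let ?\<sigma> = "enc_trm \<circ> skolemize R \<theta>'"
  have sk: "skolem_list R \<theta> = skolem_list R \<theta>'"
    using P(2) \<theta>' by (intro skolem_list_cong) simp
  have eqs: "?\<sigma> z = AFun ''s'' (AFun (ident R) [] # ANum (int i) # map ?\<sigma> (head_vars R))"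
    if "(z, i) \<in> set (numbered_ex_vars R)" for z i
    using skolemize_ex[OF that, of \<theta>'] skolemize_head[of _ R \<theta>'] by simp
  have pat: "subst ?\<sigma> (enc_pattern (head R)) = enc_fact P"
    by (simp add: subst_enc_pattern inst_head_skolemize \<theta>')
  have eq: "sat Y (subst_lit ?\<sigma> (Eq (AVar z)
      (AFun ''s'' (AFun (ident R) [] # ANum (int i) # map AVar (head_vars R)))))"
    if "(z, i) \<in> set (numbered_ex_vars R)" for z i
    using eqs[OF that] by (simp add: comp_def)
  have "Plain (subst_atom ?\<sigma> (may_infer_via_atom R)) \<in> Y"
    by (rule disj_fires[OF may_infer_via_rule_in[OF R, unfolded may_infer_via_rule_def] \<sigma>])
      (use pot pat eq in \<open>auto simp: sats_def simp del: o_apply map_map\<close>)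
  then show may: "Plain (Atom ''mayInferVia'' [AFun (ident R) [], enc_fact P, skolem_list R \<theta>]) \<in> Y"
    by (simp add: subst_may_infer_via_atom \<theta>' sk)
  show "Plain (Atom ''inferenceNeeds'' [enc_fact P, AFun (ident R) [], enc_fact Q]) \<in> Y"
    if "Q \<in> needs R P"
  proof -
    obtain p where p: "p \<in> set (body R)" "Q = inst (skolemize R \<theta>') p"
      using \<open>Q \<in> needs R P\<close> by (auto simp: needs_eq[OF \<theta>'])
    have "Plain (subst_atom ?\<sigma>
        (Atom ''inferenceNeeds'' [enc_pattern (head R), AFun (ident R) [], enc_pattern p])) \<in> Y"
      by (rule disj_fires[OF inference_needs_rule_in[OF R p(1), unfolded inference_needs_rule_def] \<sigma>])
        (use may in \<open>auto simp: sats_def subst_may_infer_via_atom \<theta>' sk\<close>)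
    then show ?thesis
      by (simp add: subst_enc_pattern inst_head_skolemize \<theta>' p(2))
  qed
qed

lemma pot_fires: "P \<in> potentials A \<Longrightarrow> Plain (Atom ''pot'' [enc_fact P]) \<in> Y"
proof (induction rule: reach.induct)
  case (start P)
  let ?\<sigma> = "(\<lambda>_. ANum 0)(''X'' := enc_fact P)"
  have P: "P \<in> potentials A"
    using start by (rule reach.start)
  have "Plain (subst_atom ?\<sigma> (Atom ''pot'' [AVar ''X''])) \<in> Y"
    by (rule disj_fires[OF pot_goal_rule])
      (use start P in \<open>auto simp: sats_def
        intro: groundings_upd groundings_ne enc_fact_in_herbrand_universe goal_fires\<close>)
  then show ?case
    by simp
next
  case (need P R Q)
  then have R: "R \<in> axioms A"
    by (simp add: all_backchains_def)
  have Q: "Q \<in> potentials A"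
    using need by (blast intro: reach.need)
  obtain \<theta> where \<theta>: "inst \<theta> (head R) = P"
    using need needs_applicable by (metis applicable_def)
  let ?\<sigma> = "(\<lambda>_. ANum 0)(''_1'' := enc_fact P, ''_2'' := AFun (ident R) [], ''P'' := enc_fact Q)"
  have "Plain (subst_atom ?\<sigma> (Atom ''pot'' [AVar ''P''])) \<in> Y"
    by (rule disj_fires[OF pot_needs_rule])
      (use Q R need.hyps may_infer_via_fires(2)[OF R need.hyps(1) \<theta> need.IH need.hyps(3)] in
        \<open>auto simp: sats_def intro!: groundings_upd groundings_ne ident_in_herbrand_universe
          intro: enc_fact_in_herbrand_universe\<close>)
  then show ?case
    by simp
qed

lemma base_fires: "Plain ` base A \<subseteq> Y"
proof -
  have "Plain (Atom ''sortname'' [AFun s []]) \<in> Y" if "s \<in> sorts A" for s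
  proof -
    have "Plain (subst_atom (\<lambda>_. ANum 0) (Atom ''sortname'' [AFun s []])) \<in> Y"
      by (rule disj_fires[where b = "[]", OF _ groundings_ne])
        (use that in \<open>auto simp: P_bpt_def sats_def\<close>)
    then show ?thesis
      by simp
  qed
  moreover have "Plain (Atom ''inferenceNeeds'' [enc_fact P, AFun (ident R) [], enc_fact Q]) \<in> Y"
    if "R \<in> axioms A" "P \<in> potentials A" "Q \<in> needs R P" for R P Q
  proof -
    obtain \<theta> where "inst \<theta> (head R) = P"
      using \<open>Q \<in> needs R P\<close> needs_applicable by (metis applicable_def)
    then show ?thesis
      using that may_infer_via_fires(2) pot_fires by blast
  qed
  ultimately show ?thesis
    using goal_fires pot_fires may_infer_via_fires(1) unfolding base_def by auto
qed

end

section \<open>Firing the rules of \<open>P_gp\<close> in models of the reduct\<close>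

lemma P_gp_rules_in:
  "Disj [Atom ''true'' [AVar ''P'']] [Pos (Atom ''goal'' [AVar ''P''])] \<in> program A"
  "Choice 1 [(Atom ''infer'' [AVar ''P''], []), (Atom ''fai'' [AVar ''P''], [])] 1
     [Pos (Atom ''true'' [AVar ''P''])] \<in> program A"
  "Choice 1
     [(Atom ''inferVia'' [AVar ''R'', AVar ''P''],
       [Pos (Atom ''mayInferVia'' [AVar ''R'', AVar ''P'', AVar ''_1''])])] 1
     [Pos (Atom ''infer'' [AVar ''P''])] \<in> program A"
  "Disj [Atom ''true'' [AVar ''Q'']]
     [Pos (Atom ''inferVia'' [AVar ''R'', AVar ''P'']),
      Pos (Atom ''inferenceNeeds'' [AVar ''P'', AVar ''R'', AVar ''Q''])] \<in> program A"
  by (simp_all add: P_gp_def)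

context reduct_model
begin

lemma true_goal_fires:
  assumes "P \<in> goals A"
  shows "Plain (Atom ''true'' [enc_fact P]) \<in> Y"
proof -
  let ?\<sigma> = "(\<lambda>_. ANum 0)(''P'' := enc_fact P)"
  have "?\<sigma> \<in> groundings (program A)"
    by (intro groundings_upd groundings_ne enc_fact_in_herbrand_universe reach.start assms)
  from disj_fires[OF P_gp_rules_in(1) this] show ?thesis
    using goal_fires[OF assms] by (simp add: sats_def)
qed

lemma infer_fai_fires:
  assumes "P \<in> potentials A" "Plain (Atom ''true'' [enc_fact P]) \<in> Y" "f \<in> {''infer'', ''fai''}"
  shows "Plain (Atom f [enc_fact P]) \<in> Y \<or> Hat (Atom f [enc_fact P]) \<in> Y"
proof -
  let ?\<sigma> = "(\<lambda>_. ANum 0)(''P'' := enc_fact P)"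
  have "?\<sigma> \<in> groundings (program A)"
    by (intro groundings_upd groundings_ne enc_fact_in_herbrand_universe assms(1))
  from choice_fires[OF P_gp_rules_in(2) _ this, of "Atom f [AVar ''P'']" "[]"] show ?thesis
    using assms(2,3) by (auto simp: sats_def)
qed

lemma infer_via_fires:
  assumes P: "P \<in> potentials A" and R: "R \<in> axioms A" "applicable R P"
    and infer: "Plain (Atom ''infer'' [enc_fact P]) \<in> Y"
  shows "Plain (Atom ''inferVia'' [AFun (ident R) [], enc_fact P]) \<in> Y \<or>
    Hat (Atom ''inferVia'' [AFun (ident R) [], enc_fact P]) \<in> Y"
proof -
  obtain \<theta> where \<theta>: "inst \<theta> (head R) = P"
    using R(2) by (auto simp: applicable_def)
  \<comment> \<open>The variable \<open>_1\<close> has to carry the Skolem list for the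
    \<open>mayInferVia\<close> condition of the choice element to hold.\<close>
  let ?\<sigma> = "(\<lambda>_. ANum 0)(''P'' := enc_fact P, ''R'' := AFun (ident R) [], ''_1'' := skolem_list R \<theta>)"
  have "?\<sigma> \<in> groundings (program A)"
    using P R \<theta> by (intro groundings_upd groundings_ne enc_fact_in_herbrand_universe
        ident_in_herbrand_universe skolem_list_in_herbrand_universe) auto
  from choice_fires[OF P_gp_rules_in(3) _ this] show ?thesis
    using infer may_infer_via_fires(1)[OF R(1) P \<theta> pot_fires[OF P]] by (auto simp: sats_def)
qed

lemma true_needs_fires:
  assumes P: "P \<in> potentials A" and R: "R \<in> axioms A" and Q: "Q \<in> needs R P"
    and via: "Plain (Atom ''inferVia'' [AFun (ident R) [], enc_fact P]) \<in> Y"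
  shows "Plain (Atom ''true'' [enc_fact Q]) \<in> Y"
proof -
  have "Q \<in> potentials A"
    using P R Q reach.need[of P "goals A" "all_backchains A" R Q] by (simp add: all_backchains_def)
  let ?\<sigma> = "(\<lambda>_. ANum 0)(''P'' := enc_fact P, ''R'' := AFun (ident R) [], ''Q'' := enc_fact Q)"
  have "?\<sigma> \<in> groundings (program A)"
    using P R \<open>Q \<in> potentials A\<close> by (intro groundings_upd groundings_ne enc_fact_in_herbrand_universe
        ident_in_herbrand_universe)
  moreover have "Plain (Atom ''inferenceNeeds'' [enc_fact P, AFun (ident R) [], enc_fact Q]) \<in> Y"
    using P R Q by (intro subsetD[OF base_fires] imageI) auto
  ultimately show ?thesis
    using disj_fires[OF P_gp_rules_in(4), of ?\<sigma>] via by (simp add: sats_def)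
qed

end

section \<open>Counting constraints and the ground rules of \<open>P_gp\<close>\<close>

lemma chosen_infer_fai:
  assumes "\<sigma> \<in> groundings Pr"
  shows "chosen Pr X \<sigma> [(Atom ''infer'' [AVar ''P''], []), (Atom ''fai'' [AVar ''P''], [])]
      [Pos (Atom ''true'' [AVar ''P''])] =
    {Hat (Atom f [\<sigma> ''P'']) | f. f \<in> {''infer'', ''fai''} \<and> Plain (Atom f [\<sigma> ''P'']) \<in> X}"
  (is "?L = ?R")
proof
  show "?L \<subseteq> ?R"
    by (auto simp: chosen_def sats_def)
  show "?R \<subseteq> ?L"
  proof
    fix x assume "x \<in> ?R"
    then obtain f where "f \<in> {''infer'', ''fai''}" "x = Hat (Atom f [\<sigma> ''P''])"
      "Plain (Atom f [\<sigma> ''P'']) \<in> X"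
      by blast
    then show "x \<in> ?L"
      using assms unfolding chosen_def
      by (intro CollectI exI[of _ \<sigma>] exI[of _ "Atom f [AVar ''P'']"] exI[of _ "[]"])
        (auto simp: sats_def)
  qed
qed

text \<open>\<open>P\<close> is global because it occurs in the body, while \<open>R\<close> and
  \<open>_1\<close> range freely. Since \<open>_1\<close> is absent from the counted atom, the bound
  counts identifiers of axioms and not Skolem lists.\<close>

lemma chosen_infer_via:
  assumes \<sigma>: "\<sigma> \<in> groundings Pr"
  shows "chosen Pr X \<sigma>
      [(Atom ''inferVia'' [AVar ''R'', AVar ''P''],
        [Pos (Atom ''mayInferVia'' [AVar ''R'', AVar ''P'', AVar ''_1''])])]
      [Pos (Atom ''infer'' [AVar ''P''])] =
    {Hat (Atom ''inferVia'' [r, \<sigma> ''P'']) | r u.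
       r \<in> herbrand_universe Pr \<and> u \<in> herbrand_universe Pr \<and>
       Plain (Atom ''inferVia'' [r, \<sigma> ''P'']) \<in> X \<and> Plain (Atom ''mayInferVia'' [r, \<sigma> ''P'', u]) \<in> X}"
  (is "?L = ?R")
proof
  show "?L \<subseteq> ?R"
    by (auto simp: chosen_def sats_def groundings_def image_subset_iff) blast
  show "?R \<subseteq> ?L"
  proof
    fix x assume "x \<in> ?R"
    then obtain r u where *: "r \<in> herbrand_universe Pr" "u \<in> herbrand_universe Pr"
      "x = Hat (Atom ''inferVia'' [r, \<sigma> ''P''])"
      "Plain (Atom ''inferVia'' [r, \<sigma> ''P'']) \<in> X" "Plain (Atom ''mayInferVia'' [r, \<sigma> ''P'', u]) \<in> X"
      by blast
    have "\<sigma>(''R'' := r, ''_1'' := u) \<in> groundings Pr"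
      using \<sigma> * by (intro groundings_upd)
    then show "x \<in> ?L"
      using * unfolding chosen_def
      by (intro CollectI exI[of _ "\<sigma>(''R'' := r, ''_1'' := u)"]) (auto simp: sats_def)
  qed
qed

text \<open>The empty head of the constraint forces its body to fail, and both bounds are 1.\<close>

lemma model_constraint:
  assumes M: "model (ground Pr) X" and r: "Choice 1 es 1 b \<in> Pr" "\<sigma> \<in> groundings Pr" "sats X \<sigma> b"
  obtains x where "chosen Pr X \<sigma> es b = {x}"
proof -
  let ?C = "chosen Pr X \<sigma> es b"
  have "({}, \<lambda>X. sats X \<sigma> b \<and> \<not> (finite (chosen Pr X \<sigma> es b) \<and>
           1 \<le> card (chosen Pr X \<sigma> es b) \<and> card (chosen Pr X \<sigma> es b) \<le> 1))
      \<in> ground_rules Pr (Choice 1 es 1 b)"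
    using r(2) by auto
  then have "({}, \<lambda>X. sats X \<sigma> b \<and> \<not> (finite (chosen Pr X \<sigma> es b) \<and>
           1 \<le> card (chosen Pr X \<sigma> es b) \<and> card (chosen Pr X \<sigma> es b) \<le> 1))
      \<in> ground Pr"
    unfolding ground_def using r(1) by blast
  then have "card ?C = 1"
    using M r(3) by (fastforce simp: model_def)
  then show ?thesis
    using that card_1_singletonE by metis
qed

text \<open>Bodies are given as functions of the interpretation, since the same ground rule is
  evaluated at an answer set and at a part of it.\<close>

lemma P_gp_cases:
  assumes "r \<in> P_gp" "(h, b) \<in> ground_rules Pr r"
  obtains
    (true_goal) \<sigma> where "h = {Plain (Atom ''true'' [\<sigma> ''P''])}"
      "b = (\<lambda>X. Plain (Atom ''goal'' [\<sigma> ''P'']) \<in> X)"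
  | (infer_fai) \<sigma> f where "f \<in> {''infer'', ''fai''}"
      "h = {Plain (Atom f [\<sigma> ''P'']), Hat (Atom f [\<sigma> ''P''])}"
      "b = (\<lambda>X. Plain (Atom ''true'' [\<sigma> ''P'']) \<in> X)"
  | (count_infer_fai) \<sigma> C where "\<sigma> \<in> groundings Pr" "h = {}"
      "C = (\<lambda>X. chosen Pr X \<sigma> [(Atom ''infer'' [AVar ''P''], []), (Atom ''fai'' [AVar ''P''], [])]
         [Pos (Atom ''true'' [AVar ''P''])])"
      "b = (\<lambda>X. Plain (Atom ''true'' [\<sigma> ''P'']) \<in> X \<and>
         \<not> (finite (C X) \<and> 1 \<le> card (C X) \<and> card (C X) \<le> 1))"
  | (infer_via) \<sigma> where "h = {Plain (Atom ''inferVia'' [\<sigma> ''R'', \<sigma> ''P'']),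
         Hat (Atom ''inferVia'' [\<sigma> ''R'', \<sigma> ''P''])}"
      "b = (\<lambda>X. Plain (Atom ''infer'' [\<sigma> ''P'']) \<in> X \<and>
         Plain (Atom ''mayInferVia'' [\<sigma> ''R'', \<sigma> ''P'', \<sigma> ''_1'']) \<in> X)"
  | (count_infer_via) \<sigma> C where "\<sigma> \<in> groundings Pr" "h = {}"
      "C = (\<lambda>X. chosen Pr X \<sigma> [(Atom ''inferVia'' [AVar ''R'', AVar ''P''],
           [Pos (Atom ''mayInferVia'' [AVar ''R'', AVar ''P'', AVar ''_1''])])]
         [Pos (Atom ''infer'' [AVar ''P''])])"
      "b = (\<lambda>X. Plain (Atom ''infer'' [\<sigma> ''P'']) \<in> X \<and>
         \<not> (finite (C X) \<and> 1 \<le> card (C X) \<and> card (C X) \<le> 1))"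
  | (true_needs) \<sigma> where "h = {Plain (Atom ''true'' [\<sigma> ''Q''])}"
      "b = (\<lambda>X. Plain (Atom ''inferVia'' [\<sigma> ''R'', \<sigma> ''P'']) \<in> X \<and>
         Plain (Atom ''inferenceNeeds'' [\<sigma> ''P'', \<sigma> ''R'', \<sigma> ''Q'']) \<in> X)"
proof -
  consider "r = Disj [Atom ''true'' [AVar ''P'']] [Pos (Atom ''goal'' [AVar ''P''])]"
    | "r = Choice 1 [(Atom ''infer'' [AVar ''P''], []), (Atom ''fai'' [AVar ''P''], [])] 1
        [Pos (Atom ''true'' [AVar ''P''])]"
    | "r = Choice 1 [(Atom ''inferVia'' [AVar ''R'', AVar ''P''],
          [Pos (Atom ''mayInferVia'' [AVar ''R'', AVar ''P'', AVar ''_1''])])] 1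
        [Pos (Atom ''infer'' [AVar ''P''])]"
    | "r = Disj [Atom ''true'' [AVar ''Q'']]
        [Pos (Atom ''inferVia'' [AVar ''R'', AVar ''P'']),
         Pos (Atom ''inferenceNeeds'' [AVar ''P'', AVar ''R'', AVar ''Q''])]"
    using assms(1) unfolding P_gp_def by blast
  then show ?thesis
  proof cases
    case 1
    with assms(2) show ?thesis
      by (auto simp: sats_def intro: true_goal)
  next
    case 2
    show ?thesis
      using assms(2) unfolding 2 ground_rules.simps
    proof (elim UnE CollectE exE conjE)
      fix \<sigma> a ls
      assume "(h, b) = ({Plain (subst_atom \<sigma> a), Hat (subst_atom \<sigma> a)},
          \<lambda>X. sats X \<sigma> [Pos (Atom ''true'' [AVar ''P''])] \<and> sats X \<sigma> ls)"
        "(a, ls) \<in> set [(Atom ''infer'' [AVar ''P''], []), (Atom ''fai'' [AVar ''P''], [])]"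
      then show ?thesis
        by (intro infer_fai[of "pred a" \<sigma>]) (auto simp: sats_def)
    qed (rule count_infer_fai, auto simp: sats_def)
  next
    case 3
    show ?thesis
      using assms(2) unfolding 3 ground_rules.simps
    proof (elim UnE CollectE exE conjE)
      fix \<sigma> a ls
      assume "(h, b) = ({Plain (subst_atom \<sigma> a), Hat (subst_atom \<sigma> a)},
          \<lambda>X. sats X \<sigma> [Pos (Atom ''infer'' [AVar ''P''])] \<and> sats X \<sigma> ls)"
        "(a, ls) \<in> set [(Atom ''inferVia'' [AVar ''R'', AVar ''P''],
           [Pos (Atom ''mayInferVia'' [AVar ''R'', AVar ''P'', AVar ''_1''])])]"
      then show ?thesis
        by (intro infer_via[of \<sigma>]) (auto simp: sats_def)
    qed (rule count_infer_via, auto simp: sats_def)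
  next
    case 4
    with assms(2) show ?thesis
      by (auto simp: sats_def intro: true_needs)
  qed
qed

lemma ground_program_cases:
  assumes "(h, b) \<in> ground (program A)"
  obtains r where "r \<in> P_bpt A" "(h, b) \<in> ground_rules (program A) r"
  | r where "r \<in> P_gp" "(h, b) \<in> ground_rules (program A) r"
  using assms by (auto simp: ground_def)


section \<open>Answer sets are encodings\<close>

lemma model_infer_xor_fai:
  assumes M: "model (ground (program A)) X" and P: "P \<in> potentials A"
    and true: "Plain (Atom ''true'' [enc_fact P]) \<in> X"
  shows "Plain (Atom ''infer'' [enc_fact P]) \<in> X \<longleftrightarrow> Plain (Atom ''fai'' [enc_fact P]) \<notin> X"
proof -
  let ?\<sigma> = "(\<lambda>_. ANum 0)(''P'' := enc_fact P)"
  have \<sigma>: "?\<sigma> \<in> groundings (program A)"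
    by (intro groundings_upd groundings_ne enc_fact_in_herbrand_universe P)
  have "sats X ?\<sigma> [Pos (Atom ''true'' [AVar ''P''])]"
    using true by (simp add: sats_def)
  from model_constraint[OF M P_gp_rules_in(2) \<sigma> this, unfolded chosen_infer_fai[OF \<sigma>]]
  obtain x where "{Hat (Atom f [?\<sigma> ''P'']) | f. f \<in> {''infer'', ''fai''} \<and>
      Plain (Atom f [?\<sigma> ''P'']) \<in> X} = {x}"
    .
  then have x: "{Hat (Atom f [enc_fact P]) | f. f \<in> {''infer'', ''fai''} \<and>
      Plain (Atom f [enc_fact P]) \<in> X} = {x}" (is "?C = _")
    by simp
  have mem: "Hat (Atom f [enc_fact P]) \<in> ?C \<longleftrightarrow> Plain (Atom f [enc_fact P]) \<in> X"
    if "f \<in> {''infer'', ''fai''}" for f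
    using that by auto
  have "\<not> (Hat (Atom ''infer'' [enc_fact P]) \<in> ?C \<and> Hat (Atom ''fai'' [enc_fact P]) \<in> ?C)"
    unfolding x by auto
  moreover have "x \<in> ?C"
    unfolding x by simp
  then have "Plain (Atom ''infer'' [enc_fact P]) \<in> X \<or> Plain (Atom ''fai'' [enc_fact P]) \<in> X"
    by auto
  ultimately show ?thesis
    using mem by auto
qed

text \<open>Distinct axioms have distinct identifiers, so one counted atom means one axiom. The
  assumption on \<open>mayInferVia\<close> guarantees that whatever is counted belongs to an
  applicable axiom.\<close>

lemma model_infer_via_unique:
  assumes A: "abduction_instance A" and M: "model (ground (program A)) X"
    and P: "P \<in> potentials A" and infer: "Plain (Atom ''infer'' [enc_fact P]) \<in> X"
    and base: "\<And>r t u. Plain (Atom ''mayInferVia'' [r, t, u]) \<in> X \<longleftrightarrow> Atom ''mayInferVia'' [r, t, u] \<in> base A"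
  shows "\<exists>!R. R \<in> axioms A \<and> applicable R P \<and> Plain (Atom ''inferVia'' [AFun (ident R) [], enc_fact P]) \<in> X"
proof -
  let ?\<sigma> = "(\<lambda>_. ANum 0)(''P'' := enc_fact P)"
  have \<sigma>: "?\<sigma> \<in> groundings (program A)"
    by (intro groundings_upd groundings_ne enc_fact_in_herbrand_universe P)
  have "sats X ?\<sigma> [Pos (Atom ''infer'' [AVar ''P''])]"
    using infer by (simp add: sats_def)
  from model_constraint[OF M P_gp_rules_in(3) \<sigma> this, unfolded chosen_infer_via[OF \<sigma>]]
  obtain x where "{Hat (Atom ''inferVia'' [r, ?\<sigma> ''P'']) | r u.
       r \<in> herbrand_universe (program A) \<and> u \<in> herbrand_universe (program A) \<and>
       Plain (Atom ''inferVia'' [r, ?\<sigma> ''P'']) \<in> X \<and> Plain (Atom ''mayInferVia'' [r, ?\<sigma> ''P'', u]) \<in> X} = {x}"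
    .
  then have x: "{Hat (Atom ''inferVia'' [r, enc_fact P]) | r u.
       r \<in> herbrand_universe (program A) \<and> u \<in> herbrand_universe (program A) \<and>
       Plain (Atom ''inferVia'' [r, enc_fact P]) \<in> X \<and> Plain (Atom ''mayInferVia'' [r, enc_fact P, u]) \<in> X} = {x}"
    (is "?C = _")
    by simp
  have mem: "x = Hat (Atom ''inferVia'' [AFun (ident R) [], enc_fact P])"
    if R: "R \<in> axioms A" "applicable R P" "Plain (Atom ''inferVia'' [AFun (ident R) [], enc_fact P]) \<in> X" for R
  proof -
    obtain \<theta> where \<theta>: "inst \<theta> (head R) = P"
      using R by (auto simp: applicable_def)
    have "Plain (Atom ''mayInferVia'' [AFun (ident R) [], enc_fact P, skolem_list R \<theta>]) \<in> X"
      unfolding base using R P \<theta> by auto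
    moreover have "AFun (ident R) [] \<in> herbrand_universe (program A)"
      "skolem_list R \<theta> \<in> herbrand_universe (program A)"
      using R P \<theta> by (auto intro: ident_in_herbrand_universe skolem_list_in_herbrand_universe)
    ultimately have "Hat (Atom ''inferVia'' [AFun (ident R) [], enc_fact P]) \<in> ?C"
      using R by blast
    then show ?thesis
      unfolding x by simp
  qed
  have "x \<in> ?C"
    unfolding x by simp
  then obtain r u where "Plain (Atom ''inferVia'' [r, enc_fact P]) \<in> X"
    "Plain (Atom ''mayInferVia'' [r, enc_fact P, u]) \<in> X"
    by blast
  then have "\<exists>R. R \<in> axioms A \<and> applicable R P \<and> Plain (Atom ''inferVia'' [AFun (ident R) [], enc_fact P]) \<in> X"
    unfolding base applicable_def by auto
  moreover have "R = R'"
    if "R \<in> axioms A \<and> applicable R P \<and> Plain (Atom ''inferVia'' [AFun (ident R) [], enc_fact P]) \<in> X"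
      "R' \<in> axioms A \<and> applicable R' P \<and> Plain (Atom ''inferVia'' [AFun (ident R') [], enc_fact P]) \<in> X"
    for R R'
    using mem[of R] mem[of R'] that ident_eq_iff[OF A, of R R'] by simp
  ultimately show ?thesis
    by (rule ex_ex1I)
qed

text \<open>From bodies true in \<open>Z\<close> the rules derive nothing outside the envelope,
  which gives \<open>Z = X\<close>. Only then can all atoms of \<open>X\<close> be decoded and the
  constraint on \<open>inferVia\<close> be read as the choice of one axiom for each back-chained
  fact.\<close>

lemma answer_set_is_encoding:
  assumes A: "abduction_instance A" and I: "answer_set (program A) I"
  shows "\<exists>J. admissible A J \<and> I = encoding A J"
proof -
  obtain X where M: "model (ground (program A)) X"
    and minimal: "\<And>Y. Y \<subset> X \<Longrightarrow> \<not> model (reduct (ground (program A)) X) Y"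
    and IX: "I = {a. Plain a \<in> X}"
    using I unfolding answer_set_def by blast
  interpret reduct_model A X X
    using A M by unfold_locales (auto simp: model_def reduct_def)
  \<comment> \<open>Neither applicability nor reachability is demanded here; both follow in
    \<open>JD\<close> once \<open>X\<close> is known to lie in the envelope.\<close>
  define J where "J = {Backchain R P | R P. R \<in> axioms A \<and>
      Plain (Atom ''inferVia'' [AFun (ident R) [], enc_fact P]) \<in> X}"
  define N where "N = reach (goals A) J"
  define M' where "M' = {P \<in> N. Plain (Atom ''infer'' [enc_fact P]) \<in> X}"
  \<comment> \<open>All \<open>Hat\<close> atoms of \<open>X\<close> are kept, so only plain head
    atoms have to be placed in the envelope.\<close>
  define Z where "Z = {x \<in> X. \<forall>a. x = Plain a \<longrightarrow> a \<in> envelope A N M'}"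
  have N: "N \<subseteq> potentials A"
    unfolding N_def by (rule reach_mono) (auto simp: J_def all_backchains_def)
  have plainZ: "Plain a \<in> Z \<longleftrightarrow> Plain a \<in> X \<and> a \<in> envelope A N M'" for a
    by (simp add: Z_def)
  have envZ: "{a. Plain a \<in> Z} \<subseteq> envelope A N M'"
    by (auto simp: plainZ)
  have "h \<inter> Z \<noteq> {}" if hb: "(h, b) \<in> ground (program A)" and bX: "b X" and bZ: "b Z" for h b
  proof -
    \<comment> \<open>This also disposes of the counting constraints, whose empty heads would
      contradict it.\<close>
    have "h \<inter> X \<noteq> {}"
      using M hb bX by (auto simp: model_def)
    moreover have "a \<in> envelope A N M'" if a: "Plain a \<in> h" "Plain a \<in> X" for a
      using hb
    proof (cases rule: ground_program_cases)
      case (1 r)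
      then have "a \<in> base A"
        using P_bpt_head[OF A envZ 1 bZ] a by auto
      then show ?thesis
        by (simp add: envelope_def)
    next
      case (2 r)
      then show ?thesis
      proof (cases rule: P_gp_cases)
        case (true_goal \<sigma>)
        then have "Atom ''goal'' [\<sigma> ''P''] \<in> envelope A N M'"
          using bZ plainZ by simp
        then show ?thesis
          using true_goal a by (auto simp: N_def intro: reach.start)
      next
        case (infer_fai \<sigma> f)
        then have "Atom ''true'' [\<sigma> ''P''] \<in> envelope A N M'"
          using bZ plainZ by simp
        then show ?thesis
          using infer_fai a by (auto simp: M'_def)
      next
        case (infer_via \<sigma>)
        then have "Atom ''infer'' [\<sigma> ''P''] \<in> envelope A N M'"
          "Atom ''mayInferVia'' [\<sigma> ''R'', \<sigma> ''P'', \<sigma> ''_1''] \<in> envelope A N M'"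
          using bZ plainZ by simp_all
        then obtain R \<theta> where "R \<in> axioms A" "inst \<theta> (head R) \<in> M'"
          "\<sigma> ''R'' = AFun (ident R) []" "\<sigma> ''P'' = enc_fact (inst \<theta> (head R))"
          by auto
        moreover from this have "applicable R (inst \<theta> (head R))"
          by (auto simp: applicable_def)
        ultimately show ?thesis
          using infer_via(1) a by auto
      next
        case (true_needs \<sigma>)
        then have "Atom ''inferVia'' [\<sigma> ''R'', \<sigma> ''P''] \<in> envelope A N M'"
          "Atom ''inferenceNeeds'' [\<sigma> ''P'', \<sigma> ''R'', \<sigma> ''Q''] \<in> envelope A N M'"
          and via: "Plain (Atom ''inferVia'' [\<sigma> ''R'', \<sigma> ''P'']) \<in> X"
          using bZ plainZ by simp_all
        then obtain R P Q R' where *: "R \<in> axioms A" "R' \<in> axioms A" "P \<in> M'" "Q \<in> needs R' P"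
          "ident R' = ident R" "\<sigma> ''R'' = AFun (ident R) []" "\<sigma> ''P'' = enc_fact P" "\<sigma> ''Q'' = enc_fact Q"
          by auto
        then have "R' = R"
          using ident_eq_iff[OF A] by blast
        \<comment> \<open>The \<open>inferVia\<close> atom lies in \<open>X\<close> and not merely
          in the envelope, which puts the operation into \<open>J\<close>; its needs are therefore
          reached.\<close>
        then have "Q \<in> N"
          using * via unfolding N_def M'_def by (auto simp: J_def intro!: reach.need[of P _ _ R Q])
        then show ?thesis
          using true_needs a * by simp
      qed (use a in simp_all)
    qed
    ultimately show ?thesis
      by (auto simp: Z_def)
  qed
  then have "model (reduct (ground (program A)) X) Z"
    by (auto simp: model_def reduct_def)
  moreover have "Z \<subseteq> X"
    by (auto simp: Z_def)
  ultimately have "Z = X"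
    using minimal by blast
  then have envX: "a \<in> envelope A N M'" if "Plain a \<in> X" for a
    using that plainZ by metis
  have baseX: "Plain a \<in> X" if "a \<in> base A" for a
    using that base_fires by blast
  have may: "Plain (Atom ''mayInferVia'' [r, t, u]) \<in> X \<longleftrightarrow> Atom ''mayInferVia'' [r, t, u] \<in> base A" for r t u
    using envX baseX envelope_simps(3) by metis
  have Jiff: "Backchain R P \<in> J \<longleftrightarrow> R \<in> axioms A \<and>
      Plain (Atom ''inferVia'' [AFun (ident R) [], enc_fact P]) \<in> X" for R P
    by (auto simp: J_def)
  have JD: "applicable R P \<and> P \<in> M'" if "Backchain R P \<in> J" for R P
  proof -
    have "Atom ''inferVia'' [AFun (ident R) [], enc_fact P] \<in> envelope A N M'"
      using that envX Jiff by blast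
    then obtain R' where "R' \<in> axioms A" "ident R' = ident R" "applicable R' P" "P \<in> M'"
      by auto
    then show ?thesis
      using that ident_eq_iff[OF A] Jiff by metis
  qed
  have trueN: "Plain (Atom ''true'' [enc_fact P]) \<in> X" if "P \<in> N" for P
    using that unfolding N_def
  proof induction
    case (start P)
    then show ?case
      by (rule true_goal_fires)
  next
    case (need P R Q)
    then show ?case
      using N Jiff unfolding N_def by (blast intro: true_needs_fires)
  qed
  have unique: "\<exists>!R. Backchain R P \<in> J" if "P \<in> M'" for P
  proof -
    have "\<exists>!R. R \<in> axioms A \<and> applicable R P \<and>
        Plain (Atom ''inferVia'' [AFun (ident R) [], enc_fact P]) \<in> X"
      using that N by (intro model_infer_via_unique[OF A M _ _ may]) (auto simp: M'_def)
    then show ?thesis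
      using JD Jiff by metis
  qed
  have infer_iff: "P \<in> M' \<longleftrightarrow> (\<exists>R. Backchain R P \<in> J)" for P
    using unique JD by blast
  have fai_iff: "Plain (Atom ''fai'' [enc_fact P]) \<in> X \<longleftrightarrow> (\<forall>R. Backchain R P \<notin> J)" if "P \<in> N" for P
    using that model_infer_xor_fai[OF M _ trueN[OF that]] N infer_iff[of P] by (auto simp: M'_def)
  have "inj_on justified J"
    using unique JD by (fastforce simp: inj_on_def J_def)
  moreover have "J \<subseteq> {Backchain R P | R P. R \<in> axioms A \<and> applicable R P \<and> P \<in> reach (goals A) J}"
    using JD by (fastforce simp: J_def M'_def N_def)
  ultimately have "admissible A J"
    by (simp add: admissible_def)
  moreover have "I = encoding A J"
  proof
    show "I \<subseteq> encoding A J"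
    proof
      fix a assume "a \<in> I"
      then have aX: "Plain a \<in> X"
        by (simp add: IX)
      from envX[OF this] show "a \<in> encoding A J"
        unfolding envelope_def
      proof (elim UnE CollectE exE conjE)
        fix R P assume a: "a = Atom ''inferVia'' [AFun (ident R) [], enc_fact P]" "R \<in> axioms A"
        then have "Backchain R P \<in> J"
          using aX Jiff by simp
        then show ?thesis
          using a by auto
      qed (use aX infer_iff fai_iff in \<open>auto simp: encoding_def N_def\<close>)
    qed
    show "encoding A J \<subseteq> I"
      using baseX trueN Jiff infer_iff fai_iff unfolding encoding_def IX N_def M'_def by blast
  qed
  ultimately show ?thesis
    by blast
qed

section \<open>Encodings are answer sets\<close>

text \<open>The alternatives that \<open>J\<close> does not take, among the choice elements whose
  disjunction has a true body. Their \<open>Hat\<close> atoms make these disjunctions true.\<close>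

definition unchosen :: "abduction \<Rightarrow> inference set \<Rightarrow> aatom set" where
  "unchosen A J =
     {Atom ''infer'' [enc_fact P] | P. P \<in> reach (goals A) J \<and> (\<forall>R. Backchain R P \<notin> J)} \<union>
     {Atom ''fai'' [enc_fact P] | R P. Backchain R P \<in> J} \<union>
     {Atom ''inferVia'' [AFun (ident R) [], enc_fact P] | R P R'.
        R \<in> axioms A \<and> applicable R P \<and> Backchain R' P \<in> J \<and> Backchain R P \<notin> J}"

definition extension :: "abduction \<Rightarrow> inference set \<Rightarrow> interp" where
  "extension A J = Plain ` encoding A J \<union> Hat ` unchosen A J"

lemma extension_simps [simp]:
  "Plain a \<in> extension A J \<longleftrightarrow> a \<in> encoding A J"
  "Hat a \<in> extension A J \<longleftrightarrow> a \<in> unchosen A J"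
  by (auto simp: extension_def)

lemma unchosen_simps [simp]:
  "Atom ''infer'' ts \<in> unchosen A J \<longleftrightarrow>
     (\<exists>P \<in> reach (goals A) J. (\<forall>R. Backchain R P \<notin> J) \<and> ts = [enc_fact P])"
  "Atom ''fai'' ts \<in> unchosen A J \<longleftrightarrow> (\<exists>R P. Backchain R P \<in> J \<and> ts = [enc_fact P])"
  "Atom ''inferVia'' ts \<in> unchosen A J \<longleftrightarrow>
     (\<exists>R P R'. R \<in> axioms A \<and> applicable R P \<and> Backchain R' P \<in> J \<and> Backchain R P \<notin> J \<and>
        ts = [AFun (ident R) [], enc_fact P])"
  by (auto simp: unchosen_def)

lemma extension_model:
  assumes A: "abduction_instance A" and J: "admissible A J"
  shows "model (ground (program A)) (extension A J)"
proof -
  let ?X = "extension A J"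
  let ?E = "envelope A (reach (goals A) J) {P. \<exists>R. Backchain R P \<in> J}"
  have env: "{a. Plain a \<in> ?X} \<subseteq> ?E"
    using admissibleD[OF J] by (simp add: encoding_def envelope_def) blast
  have "h \<inter> ?X \<noteq> {}" if hb: "(h, b) \<in> ground (program A)" and bX: "b ?X" for h b
    using hb
  proof (cases rule: ground_program_cases)
    case (1 r)
    then obtain a where "a \<in> base A" "h = {Plain a}"
      using P_bpt_head[OF A env 1 bX] by blast
    then show ?thesis
      by (simp add: encoding_def)
  next
    case (2 r)
    then show ?thesis
    proof (cases rule: P_gp_cases)
      case (true_goal \<sigma>)
      then show ?thesis
        using bX by (auto intro: reach.start)
    next
      case (infer_fai \<sigma> f)
      then obtain P where "P \<in> reach (goals A) J" "\<sigma> ''P'' = enc_fact P"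
        using bX by auto
      then show ?thesis
        using infer_fai(1,2) by auto
    next
      case (count_infer_fai \<sigma> C)
      then obtain P where P: "P \<in> reach (goals A) J" "\<sigma> ''P'' = enc_fact P"
        using bX by auto
      have "C ?X = {Hat (Atom f [enc_fact P]) | f. f \<in> {''infer'', ''fai''} \<and>
          Atom f [enc_fact P] \<in> encoding A J}"
        unfolding count_infer_fai(3) chosen_infer_fai[OF count_infer_fai(1)] P(2) by simp
      also have "\<dots> = {Hat (Atom (if \<exists>R. Backchain R P \<in> J then ''infer'' else ''fai'') [enc_fact P])}"
        using P(1) by auto
      finally show ?thesis
        using count_infer_fai(4) bX by simp
    next
      case (infer_via \<sigma>)
      then have "Atom ''infer'' [\<sigma> ''P''] \<in> encoding A J"
        and "Atom ''mayInferVia'' [\<sigma> ''R'', \<sigma> ''P'', \<sigma> ''_1''] \<in> encoding A J"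
        using bX by simp_all
      then obtain P R R' \<theta> where "Backchain R P \<in> J" "R' \<in> axioms A" "inst \<theta> (head R') = P"
        "\<sigma> ''R'' = AFun (ident R') []" "\<sigma> ''P'' = enc_fact P"
        by auto
      moreover from this have "applicable R' P"
        by (auto simp: applicable_def)
      ultimately show ?thesis
        using infer_via(1) by auto
    next
      case (count_infer_via \<sigma> C)
      then obtain P R where P: "Backchain R P \<in> J" "\<sigma> ''P'' = enc_fact P"
        using bX by auto
      note R = admissibleD[OF J P(1)]
      obtain \<theta> where \<theta>: "inst \<theta> (head R) = P"
        using R by (auto simp: applicable_def)
      have pot: "P \<in> potentials A"
        using R admissible_reach[OF J] by blast
      have may: "Atom ''mayInferVia'' [AFun (ident R) [], enc_fact P, skolem_list R \<theta>] \<in> encoding A J"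
        using R pot \<theta> by auto
      have hu: "AFun (ident R) [] \<in> herbrand_universe (program A)"
        "skolem_list R \<theta> \<in> herbrand_universe (program A)"
        using R pot \<theta> by (auto intro: ident_in_herbrand_universe skolem_list_in_herbrand_universe)
      have "C ?X = {Hat (Atom ''inferVia'' [r, enc_fact P]) | r u.
          r \<in> herbrand_universe (program A) \<and> u \<in> herbrand_universe (program A) \<and>
          Atom ''inferVia'' [r, enc_fact P] \<in> encoding A J \<and>
          Atom ''mayInferVia'' [r, enc_fact P, u] \<in> encoding A J}"
        unfolding count_infer_via(3) chosen_infer_via[OF count_infer_via(1)] P(2) by simp
      also have "\<dots> = {Hat (Atom ''inferVia'' [AFun (ident R) [], enc_fact P])}"
      proof (intro equalityI subsetI)
        fix x assume "x \<in> {Hat (Atom ''inferVia'' [r, enc_fact P]) | r u.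
          r \<in> herbrand_universe (program A) \<and> u \<in> herbrand_universe (program A) \<and>
          Atom ''inferVia'' [r, enc_fact P] \<in> encoding A J \<and>
          Atom ''mayInferVia'' [r, enc_fact P, u] \<in> encoding A J}"
        then obtain R' where "Backchain R' P \<in> J" "x = Hat (Atom ''inferVia'' [AFun (ident R') [], enc_fact P])"
          by auto
        then show "x \<in> {Hat (Atom ''inferVia'' [AFun (ident R) [], enc_fact P])}"
          using admissible_unique[OF J P(1)] by blast
      next
        fix x assume "x \<in> {Hat (Atom ''inferVia'' [AFun (ident R) [], enc_fact P])}"
        moreover have "Atom ''inferVia'' [AFun (ident R) [], enc_fact P] \<in> encoding A J"
          using P(1) by auto
        ultimately show "x \<in> {Hat (Atom ''inferVia'' [r, enc_fact P]) | r u.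
          r \<in> herbrand_universe (program A) \<and> u \<in> herbrand_universe (program A) \<and>
          Atom ''inferVia'' [r, enc_fact P] \<in> encoding A J \<and>
          Atom ''mayInferVia'' [r, enc_fact P, u] \<in> encoding A J}"
          using may hu by blast
      qed
      finally show ?thesis
        using count_infer_via(4) bX by simp
    next
      case (true_needs \<sigma>)
      then obtain R P R' Q where *: "Backchain R P \<in> J" "R' \<in> axioms A" "Q \<in> needs R' P"
        "ident R' = ident R" "\<sigma> ''Q'' = enc_fact Q"
        using bX by auto
      then have "R' = R"
        using ident_eq_iff[OF A] admissibleD[OF J *(1)] by blast
      then have "Q \<in> reach (goals A) J"
        using * admissibleD[OF J *(1)] by (blast intro: reach.need)
      then show ?thesis
        using true_needs(1) * by simp
    qed
  qed
  then show ?thesis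
    by (auto simp: model_def)
qed

text \<open>\<open>encoding A J\<close> and \<open>unchosen A J\<close> are disjoint, so no
  disjunction \<open>a | Hat a\<close> has both of its atoms in \<open>extension A J\<close>. Once
  its body holds in \<open>Y\<close>, a disjunction therefore forces the very alternative that
  \<open>extension A J\<close> contains, and induction along \<open>reach\<close> recovers all of
  it.\<close>

lemma extension_minimal:
  assumes A: "abduction_instance A" and J: "admissible A J"
    and Y: "Y \<subseteq> extension A J" "model (reduct (ground (program A)) (extension A J)) Y"
  shows "extension A J \<subseteq> Y"
proof -
  interpret reduct_model A "extension A J" Y
    using A Y by unfold_locales
  have pot: "P \<in> potentials A" if "P \<in> reach (goals A) J" for P
    using that admissible_reach[OF J] by blast
  have plain: "a \<in> encoding A J" if "Plain a \<in> Y" for a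
    using that Y(1) extension_simps(1) by blast
  have hat: "a \<in> unchosen A J" if "Hat a \<in> Y" for a
    using that Y(1) extension_simps(2) by blast
  have infer: "Plain (Atom ''infer'' [enc_fact P]) \<in> Y"
    if "Backchain R P \<in> J" "Plain (Atom ''true'' [enc_fact P]) \<in> Y" for R P
    using infer_fai_fires[OF pot[OF admissibleD(3)[OF J that(1)]] that(2), of "''infer''"]
      hat[of "Atom ''infer'' [enc_fact P]"] that(1) by auto
  have via: "Plain (Atom ''inferVia'' [AFun (ident R) [], enc_fact P]) \<in> Y"
    if "Backchain R P \<in> J" "Plain (Atom ''true'' [enc_fact P]) \<in> Y" for R P
  proof -
    note R = admissibleD[OF J that(1)]
    \<comment> \<open>Without unique identifiers another applicable axiom could make the same atom
      an unchosen alternative.\<close>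
    have "Atom ''inferVia'' [AFun (ident R) [], enc_fact P] \<notin> unchosen A J"
      using that(1) R(1) ident_eq_iff[OF A] by auto
    then show ?thesis
      using infer_via_fires[OF pot[OF R(3)] R(1,2) infer[OF that]] hat by blast
  qed
  have true: "Plain (Atom ''true'' [enc_fact P]) \<in> Y" if "P \<in> reach (goals A) J" for P
    using that
  proof induction
    case (start P)
    then show ?case
      by (rule true_goal_fires)
  next
    case (need P R Q)
    then show ?case
      using via pot admissibleD(1)[OF J] by (blast intro: true_needs_fires)
  qed
  have "Plain a \<in> Y" if "a \<in> encoding A J" for a
    using that unfolding encoding_def
  proof (elim UnE CollectE exE conjE)
    fix P assume a: "a = Atom ''fai'' [enc_fact P]" "P \<in> reach (goals A) J" "\<forall>R. Backchain R P \<notin> J"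
    then show ?thesis
      using infer_fai_fires[OF pot true, of P "''fai''"] hat[of "Atom ''fai'' [enc_fact P]"] by auto
  next
    fix R P assume "a = Atom ''infer'' [enc_fact P]" "Backchain R P \<in> J"
    then show ?thesis
      using infer[OF _ true] admissibleD(3)[OF J] by simp
  next
    fix R P assume "a = Atom ''inferVia'' [AFun (ident R) [], enc_fact P]" "Backchain R P \<in> J"
    then show ?thesis
      using via[OF _ true] admissibleD(3)[OF J] by simp
  qed (use base_fires true in blast)+
  moreover have "Hat a \<in> Y" if "a \<in> unchosen A J" for a
    using that unfolding unchosen_def
  proof (elim UnE CollectE exE conjE)
    fix P assume a: "a = Atom ''infer'' [enc_fact P]" "P \<in> reach (goals A) J" "\<forall>R. Backchain R P \<notin> J"
    then show ?thesis
      using infer_fai_fires[OF pot true, of P "''infer''"] plain[of "Atom ''infer'' [enc_fact P]"] by auto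
  next
    fix R P assume a: "a = Atom ''fai'' [enc_fact P]" "Backchain R P \<in> J"
    then show ?thesis
      using infer_fai_fires[OF pot true, of P "''fai''"] plain[of "Atom ''fai'' [enc_fact P]"]
        admissibleD(3)[OF J a(2)] by auto
  next
    fix R P R' assume a: "a = Atom ''inferVia'' [AFun (ident R) [], enc_fact P]" "R \<in> axioms A"
      "applicable R P" "Backchain R' P \<in> J" "Backchain R P \<notin> J"
    have "a \<notin> encoding A J"
    proof
      assume "a \<in> encoding A J"
      then obtain R'' where "Backchain R'' P \<in> J" "ident R'' = ident R"
        using a(1) by auto
      then show False
        using a(2,5) ident_eq_iff[OF A] admissibleD(1)[OF J] by metis
    qed
    moreover have P: "P \<in> reach (goals A) J"
      using admissibleD(3)[OF J a(4)] .
    ultimately show ?thesis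
      using infer_via_fires[OF pot[OF P] a(2,3) infer[OF a(4) true[OF P]]] plain a(1) by blast
  qed
  ultimately show ?thesis
    by (auto simp: extension_def)
qed

lemma encoding_is_answer_set:
  assumes A: "abduction_instance A" and J: "admissible A J"
  shows "answer_set (program A) (encoding A J)"
  unfolding answer_set_def
proof (intro exI conjI allI impI)
  show "model (ground (program A)) (extension A J)"
    using A J by (rule extension_model)
  show "\<not> model (reduct (ground (program A)) (extension A J)) Y" if "Y \<subset> extension A J" for Y
    using that extension_minimal[OF A J] by blast
  show "encoding A J = {a. Plain a \<in> extension A J}"
    by simp
qed

section \<open>Injectivity, the represented graph and the bijection\<close>

lemma encoding_inj:
  assumes A: "abduction_instance A" and J: "admissible A J" "admissible A J'"
    and eq: "encoding A J = encoding A J'"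
  shows "J = J'"
proof -
  have *: "K \<subseteq> K'" if K: "admissible A K" "admissible A K'" "encoding A K = encoding A K'" for K K'
  proof
    fix s assume "s \<in> K"
    then obtain R P where s: "s = Backchain R P" "Backchain R P \<in> K"
      using K(1) by (auto simp: admissible_def)
    \<comment> \<open>The \<open>inferVia\<close> atoms alone determine the operations, since
      identifiers are unique.\<close>
    then have "Atom ''inferVia'' [AFun (ident R) [], enc_fact P] \<in> encoding A K'"
      unfolding K(3)[symmetric] by auto
    then obtain R' where "Backchain R' P \<in> K'" "ident R' = ident R"
      by auto
    then show "s \<in> K'"
      using s K(1,2) ident_eq_iff[OF A] admissibleD(1) by metis
  qed
  show ?thesis
    using *[OF J eq] *[OF J(2,1) eq[symmetric]] by blast
qed

text \<open>\<open>inferenceNeeds\<close> atoms exist for all potential operations; joining them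
  with \<open>inferVia\<close> on the identifier selects the edges of \<open>J\<close>.\<close>

lemma encoding_represents:
  assumes A: "abduction_instance A" and J: "admissible A J"
  shows "represents (encoding A J) (graph_of A J)"
proof -
  define E where "E = (\<Union>s \<in> J. induced_edges s)"
  have edge: "(Q, P) \<in> E \<longleftrightarrow> (\<exists>R. Backchain R P \<in> J \<and> Q \<in> needs R P)" for Q P
  proof
    assume "(Q, P) \<in> E"
    then obtain s where s: "s \<in> J" "(Q, P) \<in> induced_edges s"
      unfolding E_def by blast
    moreover from this J obtain R P' where "s = Backchain R P'"
      unfolding admissible_def by blast
    ultimately show "\<exists>R. Backchain R P \<in> J \<and> Q \<in> needs R P"
      by auto
  qed (force simp: E_def)
  have needs: "(\<exists>r. Atom ''inferVia'' [r, t] \<in> encoding A J \<and> Atom ''inferenceNeeds'' [t, r, u] \<in> encoding A J)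
      \<longleftrightarrow> (\<exists>Q P. u = enc_fact Q \<and> t = enc_fact P \<and> (Q, P) \<in> E)" (is "?L \<longleftrightarrow> ?R") for t u
  proof
    assume ?L
    then obtain R P R' Q where *: "Backchain R P \<in> J" "t = enc_fact P" "R' \<in> axioms A"
      "ident R' = ident R" "Q \<in> needs R' P" "u = enc_fact Q"
      by auto
    then have "R' = R"
      using ident_eq_iff[OF A] admissibleD(1)[OF J] by blast
    then show ?R
      using * edge by blast
  next
    assume ?R
    then obtain Q P R where *: "u = enc_fact Q" "t = enc_fact P" "Backchain R P \<in> J" "Q \<in> needs R P"
      using edge by blast
    then have "R \<in> axioms A" "P \<in> potentials A"
      using admissibleD[OF J *(3)] admissible_reach[OF J] by blast+
    then have "Atom ''inferVia'' [AFun (ident R) [], t] \<in> encoding A J"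
      "Atom ''inferenceNeeds'' [t, AFun (ident R) [], u] \<in> encoding A J"
      using * by auto
    then show ?L
      by blast
  qed
  have "{(u, t). \<exists>r. Atom ''inferVia'' [r, t] \<in> encoding A J \<and> Atom ''inferenceNeeds'' [t, r, u] \<in> encoding A J}
      = {(enc_fact Q, enc_fact P) | Q P. (Q, P) \<in> E}"
    unfolding needs by (intro set_eqI) (auto simp: split_paired_all)
  moreover have "backchained (graph_of A J) = {P. \<exists>R. Backchain R P \<in> J}"
    by (simp add: backchained_def graph_of_def)
  moreover have "{t. Atom ''true'' [t] \<in> encoding A J} = enc_fact ` reach (goals A) J"
    by auto
  moreover have "{t. Atom ''infer'' [t] \<in> encoding A J} = enc_fact ` {P. \<exists>R. Backchain R P \<in> J}"
    by auto
  moreover have "{t. Atom ''fai'' [t] \<in> encoding A J} =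
      enc_fact ` (reach (goals A) J - {P. \<exists>R. Backchain R P \<in> J})"
    by auto
  moreover have "{(r, t). Atom ''inferVia'' [r, t] \<in> encoding A J} =
      {(AFun (ident R) [], enc_fact P) | R P. Backchain R P \<in> J}"
    by auto
  ultimately show ?thesis
    unfolding represents_def by (simp add: graph_of_def E_def)
qed

theorem proposition1:
  fixes A :: abduction
  assumes "abduction_instance A"
  shows "\<exists>f. bij_betw f {I. answer_set (P_bpt A \<union> P_gp) I}
                {G. \<exists>H \<in> hypotheses A. is_proof_graph A H G \<and> via_backchaining G} \<and>
             (\<forall>I. answer_set (P_bpt A \<union> P_gp) I \<longrightarrow> represents I (f I))"
proof -
  let ?J = "{J. admissible A J}"
  have answer_sets: "{I. answer_set (program A) I} = encoding A ` ?J"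
    using answer_set_is_encoding encoding_is_answer_set assms by blast
  have enc: "bij_betw (encoding A) ?J {I. answer_set (program A) I}"
    unfolding answer_sets bij_betw_def
    using encoding_inj[OF assms] by (auto simp: inj_on_def)
  \<comment> \<open>\<open>J\<close> is recovered from the field \<open>inferences\<close>; the
    edges would not determine it.\<close>
  have "inj_on (graph_of A) ?J"
    by (rule inj_onI) (metis graph_of_def proof_graph.ext_inject)
  then have graph: "bij_betw (graph_of A) ?J
      {G. \<exists>H \<in> hypotheses A. is_proof_graph A H G \<and> via_backchaining G}"
    unfolding backchaining_proof_graphs[OF assms] by (rule inj_on_imp_bij_betw)
  let ?f = "graph_of A \<circ> inv_into ?J (encoding A)"
  have "represents I (?f I)" if I: "answer_set (program A) I" for I
  proof -
    obtain J where "admissible A J" "I = encoding A J"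
      using I answer_set_is_encoding[OF assms] by blast
    then show ?thesis
      using encoding_represents[OF assms] bij_betw_inv_into_left[OF enc] by simp
  qed
  then show ?thesis
    using bij_betw_trans[OF bij_betw_inv_into[OF enc] graph] by blast
qed

end
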